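(* Let $\Omega_1\subset\mathbb C^n$ and $\Omega_2\subset\mathbb C^m$ be bounded domains, and suppose that there exists an isomorphism of semigroups $\varphi:E(\Omega_1)\to E(\Omega_2)$. Then $n=m$ and there exists a map $\psi:\Omega_1\to\Omega_2$ which is either biholomorphic or antibiholomorphic such that $$\varphi f=\psi\circ f\circ\psi^{-1}\qquad\text{for all } f\in E(\Omega_1).$$
   Context: A domain is a non-empty connected open set. For a domain $\Omega\subset\mathbb C^n$ ($n\ge1$), $E(\Omega)$ denotes the semigroup, under composition, of all analytic (holomorphic) maps $\Omega\to\Omega$, with the identity map as unit. An isomorphism of semigroups is a bijection that preserves the operation and sends the unit to the unit. A biholomorphic map between two domains is a one-to-one, onto analytic map whose inverse is also analytic; a map is antibiholomorphic if its complex conjugate is biholomorphic (onto the complex-conjugate domain). *)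

theory Defs
  imports "HOL-Analysis.Analysis" "HOL-Algebra.Group"
begin

definition is_domain :: "(complex ^ 'n) set \<Rightarrow> bool" where
  "is_domain \<Omega> \<longleftrightarrow> \<Omega> \<noteq> {} \<and> open \<Omega> \<and> connected \<Omega>"

text \<open>Complex Frechet differentiability: on \<open>complex ^ 'n\<close>, \<open>has_derivative\<close> only asks for a
  real-linear derivative, so complex linearity is imposed separately.\<close>

definition holomorphic_map_on :: "(complex ^ 'n \<Rightarrow> complex ^ 'm) \<Rightarrow> (complex ^ 'n) set \<Rightarrow> bool" where
  "holomorphic_map_on f \<Omega> \<longleftrightarrow>
    (\<forall>z\<in>\<Omega>. \<exists>D. Vector_Spaces.linear (*s) (*s) D \<and> (f has_derivative D) (at z within \<Omega>))"

text \<open>Maps \<open>\<Omega> \<rightarrow> \<Omega>\<close> are represented by extensional functions (\<open>undefined\<close> outside \<open>\<Omega>\<close>), so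
  that equality of elements is equality of maps on \<open>\<Omega>\<close>.\<close>

definition holo_endo :: "(complex ^ 'n) set \<Rightarrow> (complex ^ 'n \<Rightarrow> complex ^ 'n) monoid" where
  "holo_endo \<Omega> = \<lparr>carrier = {f \<in> \<Omega> \<rightarrow>\<^sub>E \<Omega>. holomorphic_map_on f \<Omega>},
                  mult = compose \<Omega>,
                  one = restrict id \<Omega>\<rparr>"

definition biholomorphic ::
    "(complex ^ 'n \<Rightarrow> complex ^ 'm) \<Rightarrow> (complex ^ 'n) set \<Rightarrow> (complex ^ 'm) set \<Rightarrow> bool" where
  "biholomorphic \<psi> A B \<longleftrightarrow>
    bij_betw \<psi> A B \<and> holomorphic_map_on \<psi> A \<and> holomorphic_map_on (inv_into A \<psi>) B"

definition vec_cnj :: "complex ^ 'n \<Rightarrow> complex ^ 'n" where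
  "vec_cnj z = (\<chi> i. cnj (z $ i))"

definition antibiholomorphic ::
    "(complex ^ 'n \<Rightarrow> complex ^ 'm) \<Rightarrow> (complex ^ 'n) set \<Rightarrow> (complex ^ 'm) set \<Rightarrow> bool" where
  "antibiholomorphic \<psi> A B \<longleftrightarrow> biholomorphic (vec_cnj \<circ> \<psi>) A (vec_cnj ` B)"

lemma holomorphic_map_on_cong:
  assumes "holomorphic_map_on f \<Omega>" "\<And>z. z \<in> \<Omega> \<Longrightarrow> g z = f z"
  shows "holomorphic_map_on g \<Omega>"
  using assms has_derivative_transform unfolding holomorphic_map_on_def by metis

lemma holomorphic_map_on_comp:
  assumes "holomorphic_map_on f A" "holomorphic_map_on g B" "f ` A \<subseteq> B"
  shows "holomorphic_map_on (g \<circ> f) A"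
  unfolding holomorphic_map_on_def
proof
  fix z assume z: "z \<in> A"
  obtain D where D: "Vector_Spaces.linear (*s) (*s) D" "(f has_derivative D) (at z within A)"
    using assms(1) z unfolding holomorphic_map_on_def by blast
  obtain D' where D': "Vector_Spaces.linear (*s) (*s) D'" "(g has_derivative D') (at (f z) within B)"
    using assms(2,3) z unfolding holomorphic_map_on_def by blast
  have "(g \<circ> f has_derivative D' \<circ> D) (at z within A)"
    using D(2) D'(2) assms(3) by (blast intro: diff_chain_within has_derivative_subset)
  moreover have "Vector_Spaces.linear (*s) (*s) (D' \<circ> D)"
    using D(1) D'(1) by (rule Vector_Spaces.linear_compose)
  ultimately show "\<exists>D. Vector_Spaces.linear (*s) (*s) D \<and> (g \<circ> f has_derivative D) (at z within A)"
    by blast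
qed

lemma holomorphic_map_on_id: "holomorphic_map_on id \<Omega>"
  unfolding holomorphic_map_on_def
  using vec.linear_id has_derivative_id by (metis id_def)

lemma monoid_holo_endo: "Group.monoid (holo_endo \<Omega>)"
proof (rule monoidI)
  fix f g assume fg: "f \<in> carrier (holo_endo \<Omega>)" "g \<in> carrier (holo_endo \<Omega>)"
  then have "holomorphic_map_on (f \<circ> g) \<Omega>"
    by (intro holomorphic_map_on_comp[where B = \<Omega>]) (auto simp: holo_endo_def)
  then have "holomorphic_map_on (compose \<Omega> f g) \<Omega>"
    by (rule holomorphic_map_on_cong) (simp add: compose_def)
  with fg show "f \<otimes>\<^bsub>holo_endo \<Omega>\<^esub> g \<in> carrier (holo_endo \<Omega>)"
    by (auto simp: holo_endo_def compose_def)
next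
  have "holomorphic_map_on (restrict id \<Omega>) \<Omega>"
    by (rule holomorphic_map_on_cong[OF holomorphic_map_on_id]) simp
  then show "\<one>\<^bsub>holo_endo \<Omega>\<^esub> \<in> carrier (holo_endo \<Omega>)"
    by (auto simp: holo_endo_def)
qed (auto simp: holo_endo_def compose_def fun_eq_iff PiE_def Pi_def extensional_def)

end

theory Submission
  imports Defs "HOL-Complex_Analysis.Conformal_Mappings"
begin

text \<open>The isomorphism matches left zeros, that is constant maps, hence is conjugation by a bijection
  \<open>\<psi>\<close>.  Images of injective elements form a base of the topology by invariance of domain,
  hence \<open>\<psi>\<close> is a homeomorphism.  Conjugating the small affine self-maps of the first domain gives
  holomorphic maps depending continuously on parameters; averaging over the translations against a
  bump function shows that \<open>\<psi>\<close> is differentiable at some point, and conjugated affine maps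
  transport this to all points.  The derivative \<open>L\<close> at a point \<open>z\<close> satisfies: \<open>L D L\<^sup>-\<^sup>1\<close> is
  complex-linear for every complex-linear \<open>D\<close> (use contractions \<open>x \<mapsto> z + \<epsilon> D (x - z)\<close>), which forces
  \<open>L\<close> to be complex-linear or antilinear, and transport by holomorphic maps makes the same
  alternative hold everywhere.\<close>

subsection \<open>Real analysis\<close>

text \<open>The hypothesis is purely algebraic, so \<psi> begins as a bare bijection, and even as a
  homeomorphism it has no derivative to work with. The only source of smoothness is that conjugates
  of holomorphic maps are holomorphic, in the point but not in any parameter: conjugating shifted
  contractions gives maps \<open>F y w\<close> that depend on the shift y no more regularly than
  \<psi> does. Integrating over y gives one function with two readings: in the target it is a mean
  of holomorphic maps, in the source it is \<psi> smoothed by a kernel. Cancelling one reading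
  against the other needs an invertible derivative, which is why Sard's and Brouwer's theorems
  enter. The boundedness of the domains makes affine test maps plentiful: every complex-linear part,
  suitably scaled, belongs to a self-map that sends any prescribed point to any other. The
  antilinear case is a genuine one, since conjugating by \<open>vec_cnj\<close> also carries
  holomorphic self-maps to holomorphic self-maps of the conjugate domain. Derivatives are therefore
  real-linear until the last step.\<close>

lemma negligible_image_singular_derivative:
  fixes g :: "complex ^ 'm \<Rightarrow> complex ^ 'm"
  assumes der: "\<And>x. x \<in> S \<Longrightarrow> (g has_derivative g' x) (at x)"
    and sing: "\<And>x. x \<in> S \<Longrightarrow> \<not> inj (g' x)"
  shows "negligible (g ` S)"
proof -
  \<comment> \<open>\<open>baby_Sard\<close> is about real coordinate spaces and ranks of real
    matrices. The index type \<open>'m bit0\<close> has twice as many elements as \<open>'m\<close>,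
    so the two spaces are linearly isomorphic over the reals.\<close>
  have dim: "DIM(complex ^ 'm) = DIM(real ^ 'm bit0)"
    by simp
  obtain f :: "complex ^ 'm \<Rightarrow> real ^ 'm bit0" and h
    where f: "linear f" and h: "linear h" and hf: "\<And>x. h (f x) = x" and fh: "\<And>x. f (h x) = x"
    using isomorphisms_UNIV_UNIV[OF dim] by metis
  have inj_f: "inj f" and inj_h: "inj h"
    using hf fh by (metis injI)+
  have f': "(f has_derivative f) (at x)" and h': "(h has_derivative h) (at y)" for x y
    using f h by (simp_all add: linear_imp_has_derivative)
  have "negligible ((f \<circ> g \<circ> h) ` f ` S)"
  proof (rule baby_Sard)
    fix x assume "x \<in> f ` S"
    then have hx: "h x \<in> S"
      using hf by auto
    have "(g \<circ> h has_derivative g' (h x) \<circ> h) (at x)"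
      by (rule diff_chain_at[OF h' der[OF hx]])
    from diff_chain_at[OF this f']
    have d: "(f \<circ> g \<circ> h has_derivative f \<circ> g' (h x) \<circ> h) (at x)"
      by (simp add: comp_assoc)
    then show "(f \<circ> g \<circ> h has_derivative f \<circ> g' (h x) \<circ> h) (at x within f ` S)"
      by (rule has_derivative_at_withinI)
    obtain u v where uv: "u \<noteq> v" "g' (h x) u = g' (h x) v"
      using sing[OF hx] by (auto simp: inj_def)
    then have "(f \<circ> g' (h x) \<circ> h) (f u) = (f \<circ> g' (h x) \<circ> h) (f v)" "f u \<noteq> f v"
      using inj_f by (simp_all add: hf inj_eq)
    then have "\<not> inj (f \<circ> g' (h x) \<circ> h)"
      by (meson injD)
    moreover have "linear (f \<circ> g' (h x) \<circ> h)"
      using d has_derivative_linear by blast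
    ultimately show "rank (matrix (f \<circ> g' (h x) \<circ> h)) < CARD('m bit0)"
      unfolding less_rank_noninjective by (simp add: matrix_vector_mul(2))
  qed simp
  then have "negligible (h ` (f \<circ> g \<circ> h) ` f ` S)"
    by (rule negligible_differentiable_image_negligible[rotated])
      (use dim h in \<open>simp_all add: linear_imp_differentiable_on\<close>)
  then show ?thesis
    by (simp add: image_image hf)
qed

text \<open>A solution u of T u = v is a fixed point of the map sending u to v + u - T u. For v
  within r / 2 of c this map preserves the closed ball, and Brouwer's theorem applies.\<close>

lemma ball_subset_perturbed_identity_image:
  fixes T :: "'a::euclidean_space \<Rightarrow> 'a"
  assumes "0 < r" and "continuous_on (cball c r) T"
    and near: "\<And>u. u \<in> cball c r \<Longrightarrow> norm (T u - u) \<le> r / 2"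
  shows "ball c (r / 2) \<subseteq> T ` cball c r"
proof
  fix v assume v: "v \<in> ball c (r / 2)"
  have "(\<lambda>u. v + u - T u) \<in> cball c r \<rightarrow> cball c r"
  proof
    fix u assume u: "u \<in> cball c r"
    have "norm ((v - c) - (T u - u)) \<le> norm (v - c) + norm (T u - u)"
      by (rule norm_triangle_ineq4)
    moreover have "norm (v - c) < r / 2"
      using v by (simp add: dist_norm norm_minus_commute)
    moreover have "c - (v + u - T u) = - ((v - c) - (T u - u))"
      by simp
    then have "dist c (v + u - T u) = norm ((v - c) - (T u - u))"
      unfolding dist_norm by (metis norm_minus_cancel)
    ultimately show "v + u - T u \<in> cball c r"
      using near[OF u] by simp
  qed
  moreover have "continuous_on (cball c r) (\<lambda>u. v + u - T u)"
    by (intro continuous_intros assms)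
  ultimately obtain u where "u \<in> cball c r" "v + u - T u = u"
    using brouwer[of "cball c r" "\<lambda>u. v + u - T u"] \<open>0 < r\<close> by auto
  then have "u \<in> cball c r" "T u = v"
    by (simp_all add: algebra_simps)
  then show "v \<in> T ` cball c r"
    by blast
qed

text \<open>The derivative of I is known at a single point, so the inverse function theorem is out
  of reach. Continuity of \<psi> takes its place: it lets the first-order expansion of I at
  \<open>\<psi> z\<close> be evaluated at the values \<open>\<psi> x\<close> and solved for the
  increment of \<psi>.\<close>

lemma differentiable_cancel_left:
  fixes \<psi> :: "'a::euclidean_space \<Rightarrow> 'b::euclidean_space" and I :: "'b \<Rightarrow> 'b"
  assumes I': "(I has_derivative I') (at (\<psi> z))" and "inj I'"
    and H: "((\<lambda>x. I (\<psi> x)) has_derivative H') (at z)" and cont: "isCont \<psi> z"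
  shows "\<exists>L. (\<psi> has_derivative L) (at z)"
proof -
  have "linear I'"
    using I' has_derivative_linear by blast
  then obtain J where J: "linear J" "J \<circ> I' = id"
    using linear_injective_left_inverse \<open>inj I'\<close> by blast
  define Q where "Q = (\<lambda>w. J (I w))"
  define L where "L = J \<circ> H'"
  have J': "(J has_derivative J) (at x)" for x
    using J by (simp add: linear_imp_has_derivative)
  have Q: "(Q has_derivative id) (at (\<psi> z))"
    using diff_chain_at[OF I' J'] J(2) by (simp add: Q_def o_def)
  have QL: "((\<lambda>x. Q (\<psi> x)) has_derivative L) (at z)"
    using diff_chain_at[OF H J'] by (simp add: Q_def L_def o_def)
  then have L: "bounded_linear L"
    by (rule has_derivative_bounded_linear)
  then obtain K where K: "0 < K" "\<And>x. norm (L x) \<le> norm x * K"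
    using bounded_linear.pos_bounded by blast
  have "(\<psi> has_derivative L) (at z)"
    unfolding has_derivative_at_alt
  proof (intro conjI allI impI)
    fix e :: real assume e: "0 < e"
    \<comment> \<open>The cap 1 / 2 lets the error term be absorbed, which yields norm ?D \<le> 2 (K
      + 1) norm ?h; the other bound makes e1 times this at most e / 2 times norm ?h. For
      \<open>e2\<close>, the cap 1 produces the summand 1 in K + 1, and e / 2 is the remaining half
      of the error.\<close>
    define e1 where "e1 = min (1 / 2) (e / (4 * (K + 1)))"
    define e2 where "e2 = min 1 (e / 2)"
    have "e1 \<le> e / (4 * (K + 1))"
      by (simp add: e1_def)
    moreover have "0 < 4 * (K + 1)"
      using K by simp
    ultimately have "e1 * (4 * (K + 1)) \<le> e"
      by (simp only: pos_le_divide_eq)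
    then have e1: "e1 * (2 * (K + 1)) \<le> e / 2"
      by (simp add: algebra_simps)
    have e1': "0 < e1" "e1 \<le> 1 / 2"
      using e K unfolding e1_def by (simp_all only: min_less_iff_conj min.cobounded1) simp_all
    have e2: "0 < e2" "e2 \<le> 1" "e2 \<le> e / 2"
      using e by (auto simp: e2_def)
    obtain d1 where d1: "0 < d1"
      "\<And>w. norm (w - \<psi> z) < d1 \<Longrightarrow> norm (Q w - Q (\<psi> z) - (w - \<psi> z)) \<le> e1 * norm (w - \<psi> z)"
      using Q e1'(1) unfolding has_derivative_at_alt by (metis id_apply)
    obtain d2 where d2: "0 < d2"
      "\<And>x. norm (x - z) < d2 \<Longrightarrow> norm (Q (\<psi> x) - Q (\<psi> z) - L (x - z)) \<le> e2 * norm (x - z)"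
      using QL e2(1) unfolding has_derivative_at_alt by metis
    obtain d3 where d3: "0 < d3" "\<And>x. norm (x - z) < d3 \<Longrightarrow> norm (\<psi> x - \<psi> z) < d1"
      using cont d1(1) unfolding continuous_at_eps_delta dist_norm by metis
    have "norm (\<psi> x - \<psi> z - L (x - z)) \<le> e * norm (x - z)" if x: "norm (x - z) < min d2 d3" for x
    proof -
      let ?q = "Q (\<psi> x) - Q (\<psi> z)" and ?D = "\<psi> x - \<psi> z" and ?h = "x - z"
      have 1: "norm (?q - ?D) \<le> e1 * norm ?D" and 2: "norm (?q - L ?h) \<le> e2 * norm ?h"
        using x d1 d2 d3 by auto
      have "e1 * norm ?D \<le> 1 / 2 * norm ?D"
        using e1' by (intro mult_right_mono) auto
      with 1 have "norm ?D \<le> 2 * norm ?q"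
        using norm_triangle_ineq2[of ?D ?q] by (simp add: norm_minus_commute)
      moreover have "norm ?q \<le> K * norm ?h + e2 * norm ?h"
        using 2 K(2)[of ?h] norm_triangle_ineq2[of ?q "L ?h"] by (simp add: mult.commute)
      moreover have "e2 * norm ?h \<le> 1 * norm ?h"
        using e2 by (intro mult_right_mono) auto
      ultimately have "norm ?D \<le> 2 * (K + 1) * norm ?h"
        by (simp add: algebra_simps)
      then have "e1 * norm ?D \<le> e1 * (2 * (K + 1) * norm ?h)"
        using e1' by (intro mult_left_mono) auto
      also have "\<dots> \<le> e / 2 * norm ?h"
        using e1 mult_right_mono[OF e1, of "norm ?h"] by (simp add: mult.assoc)
      finally have "norm (?q - ?D) \<le> e / 2 * norm ?h"
        using 1 by simp
      moreover have "norm (?q - L ?h) \<le> e / 2 * norm ?h"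
        using 2 mult_right_mono[OF e2(3), of "norm ?h"] by simp
      ultimately show ?thesis
        using norm_triangle_sub[of "?D - L ?h" "?q - L ?h"] by (simp add: norm_minus_commute)
    qed
    then show "\<exists>d>0. \<forall>y. norm (y - z) < d \<longrightarrow> norm (\<psi> y - \<psi> z - L (y - z)) \<le> e * norm (y - z)"
      using d2(1) d3(1) by (metis min_less_iff_conj)
  qed (rule L)
  then show ?thesis
    by blast
qed

text \<open>The Lipschitz bound at \<open>x0\<close> also bounds the derivative by K, so the
  normalised remainder is dominated by 2 K and dominated convergence along sequences applies.
  Measurability of the derivative comes from its being a limit of difference quotients.\<close>

lemma has_derivative_integral_dominated:
  fixes g :: "'a::euclidean_space \<Rightarrow> 'y \<Rightarrow> 'b::euclidean_space"
  assumes S: "open S" "x0 \<in> S"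
    and int: "\<And>x. x \<in> S \<Longrightarrow> integrable M (g x)"
    and der: "\<And>y. y \<in> space M \<Longrightarrow> ((\<lambda>x. g x y) has_derivative g' y) (at x0)"
    and lip: "\<And>x y. x \<in> S \<Longrightarrow> y \<in> space M \<Longrightarrow> norm (g x y - g x0 y) \<le> K y * norm (x - x0)"
    and K: "integrable M K"
  shows "((\<lambda>x. \<integral>y. g x y \<partial>M) has_derivative (\<lambda>h. \<integral>y. g' y h \<partial>M)) (at x0)"
proof -
  have lin: "linear (g' y)" if "y \<in> space M" for y
    using der[OF that] has_derivative_linear by blast
  have quot: "(\<lambda>n. of_nat (Suc n) *\<^sub>R (g (x0 + inverse (of_nat (Suc n)) *\<^sub>R h) y - g x0 y))
      \<longlonglongrightarrow> g' y h" if y: "y \<in> space M" for y h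
  proof -
    define \<phi> where "\<phi> = (\<lambda>t. g (x0 + t *\<^sub>R h) y)"
    define t where "t n = inverse (real (Suc n))" for n
    have "((\<lambda>t. x0 + t *\<^sub>R h) has_derivative (\<lambda>t. t *\<^sub>R h)) (at 0)"
      by (auto intro!: derivative_eq_intros)
    moreover have "((\<lambda>x. g x y) has_derivative g' y) (at (x0 + 0 *\<^sub>R h))"
      using der[OF y] by simp
    ultimately have "((\<lambda>x. g x y) \<circ> (\<lambda>t. x0 + t *\<^sub>R h) has_derivative g' y \<circ> (\<lambda>t. t *\<^sub>R h)) (at 0)"
      by (rule diff_chain_at)
    then have "(\<phi> has_derivative (\<lambda>t. t *\<^sub>R g' y h)) (at 0)"
      using lin[OF y] by (simp add: \<phi>_def o_def linear_scale)
    then have "((\<lambda>t. (\<phi> t - \<phi> 0 - t *\<^sub>R g' y h) /\<^sub>R norm t) \<longlongrightarrow> 0) (at 0)"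
      by (simp add: has_derivative_at_within)
    moreover have "filterlim t (at 0) sequentially"
      using LIMSEQ_inverse_real_of_nat unfolding t_def by (simp add: filterlim_at del: of_nat_Suc)
    ultimately have "(\<lambda>n. (\<phi> (t n) - \<phi> 0 - t n *\<^sub>R g' y h) /\<^sub>R norm (t n)) \<longlonglongrightarrow> 0"
      by (rule filterlim_compose)
    moreover have "(\<phi> (t n) - \<phi> 0 - t n *\<^sub>R g' y h) /\<^sub>R norm (t n)
        = of_nat (Suc n) *\<^sub>R (g (x0 + inverse (of_nat (Suc n)) *\<^sub>R h) y - g x0 y) - g' y h" for n
      by (simp add: \<phi>_def t_def scaleR_diff_right del: of_nat_Suc)
    ultimately show ?thesis
      by (simp add: Lim_null[of _ "g' y h"])
  qed
  have bnd: "norm (g' y h) \<le> K y * norm h" if y: "y \<in> space M" for y h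
  proof -
    have "(\<lambda>n. x0 + inverse (of_nat (Suc n)) *\<^sub>R h) \<longlonglongrightarrow> x0 + 0 *\<^sub>R h"
      by (intro tendsto_intros LIMSEQ_inverse_real_of_nat)
    then have "eventually (\<lambda>n. x0 + inverse (of_nat (Suc n)) *\<^sub>R h \<in> S) sequentially"
      using S by (auto intro: topological_tendstoD)
    then have "eventually (\<lambda>n. norm (of_nat (Suc n) *\<^sub>R (g (x0 + inverse (of_nat (Suc n)) *\<^sub>R h) y - g x0 y))
        \<le> K y * norm h) sequentially"
    proof eventually_elim
      case (elim n)
      from lip[OF elim y] have
        "of_nat (Suc n) * norm (g (x0 + inverse (of_nat (Suc n)) *\<^sub>R h) y - g x0 y)
          \<le> of_nat (Suc n) * (K y * (inverse (of_nat (Suc n)) * norm h))"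
        by (intro mult_left_mono) auto
      also have "\<dots> = K y * norm h"
        by simp
      finally show ?case
        by simp
    qed
    then show ?thesis
      using tendsto_norm[OF quot[OF y]] tendsto_upperbound sequentially_bot by blast
  qed
  have int_K: "integrable M (\<lambda>y. c * K y)" for c
    using K by simp
  have meas: "(\<lambda>y. g' y h) \<in> borel_measurable M" for h
  proof -
    define a where "a = (\<lambda>n. x0 + inverse (of_nat (Suc n)) *\<^sub>R h)"
    have "a \<longlonglongrightarrow> x0 + 0 *\<^sub>R h"
      unfolding a_def by (intro tendsto_intros LIMSEQ_inverse_real_of_nat)
    then have "eventually (\<lambda>n. a n \<in> S) sequentially"
      using S by (auto intro: topological_tendstoD)
    \<comment> \<open>Integrability is known only for parameters in S, so the sequence of quotients
      is started at N.\<close>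
    then obtain N where N: "\<And>n. n \<ge> N \<Longrightarrow> a n \<in> S"
      unfolding eventually_sequentially by blast
    show ?thesis
    proof (rule borel_measurable_LIMSEQ_metric)
      fix n
      have "g (a (n + N)) \<in> borel_measurable M" "g x0 \<in> borel_measurable M"
        using int N S by auto
      then show "(\<lambda>y. of_nat (Suc (n + N)) *\<^sub>R (g (a (n + N)) y - g x0 y)) \<in> borel_measurable M"
        by measurable
    next
      fix y assume "y \<in> space M"
      then show "(\<lambda>n. of_nat (Suc (n + N)) *\<^sub>R (g (a (n + N)) y - g x0 y)) \<longlonglongrightarrow> g' y h"
        using LIMSEQ_ignore_initial_segment[OF quot, where k = N] unfolding a_def by simp
    qed
  qed
  have int': "integrable M (\<lambda>y. g' y h)" for h
  proof (rule Bochner_Integration.integrable_bound[OF int_K meas])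
    have "norm (g' y h) \<le> norm (norm h * K y)" if "y \<in> space M" for y
      using bnd[OF that, of h] by (simp add: mult.commute)
    then show "AE y in M. norm (g' y h) \<le> norm (norm h * K y)"
      by (rule AE_I2)
  qed
  define D where "D = (\<lambda>h. \<integral>y. g' y h \<partial>M)"
  have "linear D"
  proof (rule linearI)
    fix u v :: 'a and c :: real
    have "D (u + v) = (\<integral>y. g' y u + g' y v \<partial>M)"
      unfolding D_def by (rule Bochner_Integration.integral_cong) (simp_all add: lin linear_add)
    then show "D (u + v) = D u + D v"
      using int' by (simp add: D_def)
    have "D (c *\<^sub>R u) = (\<integral>y. c *\<^sub>R g' y u \<partial>M)"
      unfolding D_def by (rule Bochner_Integration.integral_cong) (simp_all add: lin linear_scale)
    then show "D (c *\<^sub>R u) = c *\<^sub>R D u"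
      by (simp add: D_def)
  qed
  then have "bounded_linear D"
    by (simp add: linear_conv_bounded_linear)
  moreover have "((\<lambda>x. ((\<integral>y. g x y \<partial>M) - (\<integral>y. g x0 y \<partial>M) - D (x - x0)) /\<^sub>R norm (x - x0)) \<longlongrightarrow> 0) (at x0 within S)"
    unfolding tendsto_at_iff_sequentially
  proof (intro allI impI)
    fix X assume X: "\<forall>i. X i \<in> S - {x0}" "X \<longlonglongrightarrow> x0"
    define s where "s = (\<lambda>i y. (g (X i) y - g x0 y - g' y (X i - x0)) /\<^sub>R norm (X i - x0))"
    have XS: "X i \<in> S" "X i \<noteq> x0" for i
      using X by auto
    have "(\<lambda>i. \<integral>y. s i y \<partial>M) \<longlonglongrightarrow> (\<integral>y. 0 \<partial>M)"
    proof (rule integral_dominated_convergence)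
      show "s i \<in> borel_measurable M" for i
        unfolding s_def using int int' XS S by (intro borel_measurable_integrable) auto
      show "AE y in M. (\<lambda>i. s i y) \<longlonglongrightarrow> 0"
      proof (rule AE_I2)
        fix y assume "y \<in> space M"
        then have "((\<lambda>x. (g x y - g x0 y - g' y (x - x0)) /\<^sub>R norm (x - x0)) \<longlongrightarrow> 0) (at x0)"
          using der by (simp add: has_derivative_at_within)
        moreover have "filterlim X (at x0) sequentially"
          using X XS by (simp add: filterlim_at)
        ultimately show "(\<lambda>i. s i y) \<longlonglongrightarrow> 0"
          unfolding s_def by (rule filterlim_compose)
      qed
      show "AE y in M. norm (s i y) \<le> 2 * K y" for i
      proof (rule AE_I2)
        fix y assume y: "y \<in> space M"
        have "norm (g (X i) y - g x0 y - g' y (X i - x0)) \<le> K y * norm (X i - x0) + K y * norm (X i - x0)"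
          using lip[OF XS(1) y] bnd[OF y] norm_triangle_ineq4 by (meson add_mono order_trans)
        then have "norm (g (X i) y - g x0 y - g' y (X i - x0)) \<le> 2 * K y * norm (X i - x0)"
          by simp
        then show "norm (s i y) \<le> 2 * K y"
          using XS(2)[of i] by (simp add: s_def divide_simps inverse_eq_divide)
      qed
    qed (use K in simp_all)
    moreover have "(\<integral>y. s i y \<partial>M) = ((\<integral>y. g (X i) y \<partial>M) - (\<integral>y. g x0 y \<partial>M) - D (X i - x0)) /\<^sub>R norm (X i - x0)" for i
      using int int' XS S by (simp add: s_def D_def)
    ultimately show "((\<lambda>x. ((\<integral>y. g x y \<partial>M) - (\<integral>y. g x0 y \<partial>M) - D (x - x0)) /\<^sub>R norm (x - x0)) \<circ> X) \<longlonglongrightarrow> 0"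
      by (simp add: o_def)
  qed
  ultimately have "((\<lambda>x. \<integral>y. g x y \<partial>M) has_derivative D) (at x0 within S)"
    by (simp add: has_derivative_at_within)
  then show ?thesis
    unfolding D_def at_within_open[OF S(2,1)] .
qed

lemma has_real_derivative_max_0_square:
  "((\<lambda>t::real. (max 0 t)\<^sup>2) has_real_derivative 2 * max 0 t) (at t)"
proof -
  consider "t < 0" | "t = 0" | "t > 0"
    by linarith
  then show ?thesis
  proof cases
    case 1
    have "((\<lambda>t::real. 0) has_real_derivative 0) (at t)"
      by simp
    then have "((\<lambda>t::real. (max 0 t)\<^sup>2) has_real_derivative 0) (at t)"
      by (rule has_field_derivative_transform_within_open[where S = "{..<0}"]) (use 1 in auto)
    then show ?thesis
      using 1 by simp
  next
    case 2
    have "((\<lambda>h::real. (max 0 h)\<^sup>2 / h) \<longlongrightarrow> 0) (at 0)"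
    proof (rule Lim_null_comparison)
      show "\<forall>\<^sub>F h::real in at 0. norm ((max 0 h)\<^sup>2 / h) \<le> \<bar>h\<bar>"
        by (intro always_eventually) (auto simp: max_def power2_eq_square)
      show "((\<lambda>h::real. \<bar>h\<bar>) \<longlongrightarrow> 0) (at 0)"
        by (rule tendsto_rabs_zero) simp
    qed
    then show ?thesis
      using 2 by (simp add: DERIV_def)
  next
    case 3
    have "((\<lambda>t::real. t\<^sup>2) has_real_derivative 2 * t) (at t)"
      by (auto intro!: derivative_eq_intros)
    then have "((\<lambda>t::real. (max 0 t)\<^sup>2) has_real_derivative 2 * t) (at t)"
      by (rule has_field_derivative_transform_within_open[where S = "{0<..}"]) (use 3 in auto)
    then show ?thesis
      using 3 by simp
  qed
qed

text \<open>The kernel is the normalised square of the positive part of \<delta>^2 - |x|^2; squaring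
  smooths the kink at the sphere of radius \<delta>. Lipschitz constants on balls are the form
  needed later, where the argument y - u ranges over a bounded set.\<close>

lemma exists_bump:
  assumes "0 < \<delta>"
  obtains k :: "'a::euclidean_space \<Rightarrow> real" where
    "\<And>x. 0 \<le> k x" and "\<And>x. \<delta> \<le> norm x \<Longrightarrow> k x = 0" and "\<And>x. k differentiable (at x)"
    and "\<And>R. \<exists>C. \<forall>x y. norm x \<le> R \<longrightarrow> norm y \<le> R \<longrightarrow> \<bar>k x - k y\<bar> \<le> C * norm (x - y)"
    and "continuous_on UNIV k" and "integrable lborel k" and "(\<integral>x. k x \<partial>lborel) = 1"
proof -
  define b :: "'a \<Rightarrow> real" where "b = (\<lambda>x. (max 0 (\<delta>\<^sup>2 - x \<bullet> x))\<^sup>2)"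
  have b_nonneg: "0 \<le> b x" for x
    by (simp add: b_def)
  have b_zero: "b x = 0 \<longleftrightarrow> \<delta> \<le> norm x" for x
  proof -
    have "\<delta>\<^sup>2 \<le> x \<bullet> x \<longleftrightarrow> \<delta> \<le> norm x"
      using assms by (simp add: dot_square_norm abs_le_square_iff[symmetric])
    then show ?thesis
      by (auto simp: b_def max_def)
  qed
  have b_diff: "b differentiable (at x)" for x
  proof -
    have "((\<lambda>x::'a. \<delta>\<^sup>2 - x \<bullet> x) has_derivative (\<lambda>h. - (x \<bullet> h + h \<bullet> x))) (at x)"
      by (auto intro!: derivative_eq_intros)
    from diff_chain_at[OF this has_real_derivative_max_0_square[unfolded has_field_derivative_def]]
    show ?thesis
      unfolding b_def o_def differentiable_def by blast
  qed
  then have b_cont: "continuous_on UNIV b"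
    using differentiable_imp_continuous_within by (force simp: continuous_on_eq_continuous_within)
  \<comment> \<open>The constant is a product: 2 \<delta>^2 for the squared positive part below
    \<delta>^2, and 2 |R| for the squared norm on the ball.\<close>
  have b_lip: "\<bar>b x - b y\<bar> \<le> (4 * \<delta>\<^sup>2 * \<bar>R\<bar>) * norm (x - y)" if "norm x \<le> R" "norm y \<le> R" for x y R
  proof -
    have m: "\<bar>(max 0 s)\<^sup>2 - (max 0 t)\<^sup>2\<bar> \<le> 2 * \<delta>\<^sup>2 * \<bar>s - t\<bar>" if "s \<le> \<delta>\<^sup>2" "t \<le> \<delta>\<^sup>2" for s t :: real
    proof -
      have "\<bar>(max 0 s)\<^sup>2 - (max 0 t)\<^sup>2\<bar> = (max 0 s + max 0 t) * \<bar>max 0 s - max 0 t\<bar>"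
        by (simp add: power2_eq_square square_diff_square_factored abs_mult)
      moreover have "max 0 s + max 0 t \<le> \<delta>\<^sup>2 + \<delta>\<^sup>2"
        using that by (intro add_mono) auto
      then have "(max 0 s + max 0 t) * \<bar>max 0 s - max 0 t\<bar> \<le> (\<delta>\<^sup>2 + \<delta>\<^sup>2) * \<bar>s - t\<bar>"
        by (rule mult_mono) auto
      ultimately show ?thesis
        by simp
    qed
    have "\<bar>x \<bullet> x - y \<bullet> y\<bar> = \<bar>(x + y) \<bullet> (x - y)\<bar>"
      by (simp add: inner_diff_right inner_add_left inner_commute[of y x])
    also have "\<dots> \<le> norm (x + y) * norm (x - y)"
      by (rule Cauchy_Schwarz_ineq2)
    also have "\<dots> \<le> (2 * \<bar>R\<bar>) * norm (x - y)"
      using that norm_triangle_ineq[of x y] by (intro mult_right_mono) auto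
    finally have *: "2 * \<delta>\<^sup>2 * \<bar>(\<delta>\<^sup>2 - x \<bullet> x) - (\<delta>\<^sup>2 - y \<bullet> y)\<bar> \<le> 2 * \<delta>\<^sup>2 * (2 * \<bar>R\<bar> * norm (x - y))"
      by (intro mult_left_mono) auto
    have "\<bar>b x - b y\<bar> \<le> 2 * \<delta>\<^sup>2 * \<bar>(\<delta>\<^sup>2 - x \<bullet> x) - (\<delta>\<^sup>2 - y \<bullet> y)\<bar>"
      unfolding b_def by (rule m) auto
    from order_trans[OF this *] show ?thesis
      by (simp add: mult.assoc)
  qed
  have "integrable lborel (\<lambda>x. indicator (cball 0 \<delta>) x *\<^sub>R b x)"
    by (intro borel_integrable_compact continuous_on_subset[OF b_cont]) auto
  moreover have "(\<lambda>x. indicator (cball 0 \<delta>) x *\<^sub>R b x) = b"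
  proof
    show "indicator (cball 0 \<delta>) x *\<^sub>R b x = b x" for x
      using b_zero[of x] by (cases "norm x \<le> \<delta>") auto
  qed
  ultimately have b_int: "integrable lborel b"
    by simp
  have "(\<integral>x. b x \<partial>lborel) \<noteq> 0"
  proof
    assume "(\<integral>x. b x \<partial>lborel) = 0"
    then have "AE x in lborel. b x = 0"
      using integral_nonneg_eq_0_iff_AE[OF b_int] b_nonneg by simp
    then have "AE x in lborel. x \<notin> ball (0::'a) \<delta>"
      by eventually_elim (simp add: b_zero)
    then have "negligible (ball (0::'a) \<delta>)"
      using AE_iff_null_sets[of "ball (0::'a) \<delta>" lborel]
      by (simp add: negligible_iff_null_sets null_sets_completionI)
    then show False
      using open_not_negligible[of "ball (0::'a) \<delta>"] assms by simp
  qed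
  then have pos: "0 < (\<integral>x. b x \<partial>lborel)"
    using b_nonneg by (simp add: order_less_le)
  define k where "k = (\<lambda>x. b x / (\<integral>x. b x \<partial>lborel))"
  show ?thesis
  proof
    show "k differentiable (at x)" for x
      unfolding k_def using b_diff by (simp add: divide_inverse)
    show "\<exists>C. \<forall>x y. norm x \<le> R \<longrightarrow> norm y \<le> R \<longrightarrow> \<bar>k x - k y\<bar> \<le> C * norm (x - y)" for R
    proof (intro exI allI impI)
      fix x y :: 'a assume "norm x \<le> R" "norm y \<le> R"
      then show "\<bar>k x - k y\<bar> \<le> (4 * \<delta>\<^sup>2 * \<bar>R\<bar>) / (\<integral>x. b x \<partial>lborel) * norm (x - y)"
        using b_lip[of x R y] pos by (simp add: k_def divide_simps flip: diff_divide_distrib)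
    qed
    show "continuous_on UNIV k"
      unfolding k_def using pos b_cont by (intro continuous_intros) auto
    show "0 \<le> k x" for x
      using b_nonneg[of x] pos by (simp add: k_def)
    show "k x = 0" if "\<delta> \<le> norm x" for x
      using b_zero[of x] that by (simp add: k_def)
    show "integrable lborel k"
      unfolding k_def using b_int by (rule integrable_divide_zero)
    show "(\<integral>x. k x \<partial>lborel) = 1"
      unfolding k_def using pos by simp
  qed
qed

subsection \<open>Holomorphic maps\<close>

lemma norm_vector_smult: "norm (c *s x) = norm c * norm (x :: complex ^ 'n)"
  by (simp add: norm_vec_def norm_mult L2_set_right_distrib)

lemma scaleR_eq_vector_smult: "r *\<^sub>R x = complex_of_real r *s (x :: complex ^ 'n)"
  by (simp add: vec_eq_iff) (simp add: scaleR_conv_of_real)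

lemma complex_linear_imp_bounded_linear:
  fixes D :: "complex ^ 'n \<Rightarrow> complex ^ 'm"
  assumes "Vector_Spaces.linear (*s) (*s) D"
  shows "bounded_linear D"
proof -
  interpret Vector_Spaces.linear "(*s)" "(*s)" D by fact
  have "linear D"
    by (rule linearI) (simp_all add: add scaleR_eq_vector_smult scale)
  then show ?thesis
    by (simp add: linear_conv_bounded_linear)
qed

lemma holomorphic_map_on_affine:
  fixes D :: "complex ^ 'n \<Rightarrow> complex ^ 'm"
  assumes "Vector_Spaces.linear (*s) (*s) D"
  shows "holomorphic_map_on (\<lambda>z. b + D (z - a)) S"
proof -
  have "((\<lambda>z. z - a) has_derivative (\<lambda>h. h)) (at z within S)" for z
    by (auto intro!: derivative_eq_intros)
  then have "((\<lambda>z. D (z - a)) has_derivative D) (at z within S)" for z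
    by (rule bounded_linear.has_derivative[OF complex_linear_imp_bounded_linear[OF assms]])
  then have "((\<lambda>z. b + D (z - a)) has_derivative D) (at z within S)" for z
    by (auto intro!: derivative_eq_intros)
  then show ?thesis
    using assms unfolding holomorphic_map_on_def by blast
qed

lemma holomorphic_map_on_open:
  assumes "open S"
  shows "holomorphic_map_on f S \<longleftrightarrow>
    (\<forall>z\<in>S. \<exists>D. Vector_Spaces.linear (*s) (*s) D \<and> (f has_derivative D) (at z))"
  unfolding holomorphic_map_on_def using at_within_open[OF _ assms] by simp

lemma holomorphic_map_on_imp_continuous_on: "holomorphic_map_on f S \<Longrightarrow> continuous_on S f"
  unfolding holomorphic_map_on_def continuous_on_eq_continuous_within
  using has_derivative_continuous by blast

lemma bounded_linear_vector_smult_left: "bounded_linear (\<lambda>c. c *s (v :: complex ^ 'n))"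
proof (rule bounded_linear_intro[where K = "norm v"])
  show "norm (c *s v) \<le> norm c * norm v" for c
    by (simp add: norm_vector_smult)
qed (simp_all add: vector_sadd_rdistrib scaleR_eq_vector_smult vector_smult_assoc scaleR_conv_of_real)

text \<open>Restriction to the complex line through two points reduces this to the Schwarz lemma.\<close>

lemma holomorphic_map_on_lipschitz_at:
  fixes f :: "complex ^ 'n \<Rightarrow> complex ^ 'm"
  assumes hol: "holomorphic_map_on f (ball w r)" and M: "\<And>z. z \<in> ball w r \<Longrightarrow> norm (f z) \<le> M"
    and z: "z \<in> ball w r"
  shows "norm (f z - f w) \<le> CARD('m) * ((2 * M + 1) / r) * norm (z - w)"
proof (cases "z = w")
  case False
  then have r: "0 < r" and nz: "0 < norm (z - w)"
    using z by (auto intro: le_less_trans[OF zero_le_dist])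
  have M0: "0 \<le> M"
    using M[OF z] norm_ge_zero order_trans by blast
  \<comment> \<open>With length r, the unit disc parametrises the part of the complex line through w
    and z that lies in the ball.\<close>
  define u where "u = (r / norm (z - w)) *\<^sub>R (z - w)"
  have nu: "norm u = r"
    using nz r by (simp add: u_def)
  have line: "w + \<zeta> *s u \<in> ball w r" if "norm \<zeta> < 1" for \<zeta>
    using that r by (simp add: dist_norm norm_vector_smult nu)
  define \<zeta> where "\<zeta> = complex_of_real (norm (z - w) / r)"
  have \<zeta>: "norm \<zeta> = norm (z - w) / r" "norm \<zeta> < 1"
    using z r unfolding \<zeta>_def norm_of_real by (simp_all add: dist_norm norm_minus_commute)
  have z_eq: "w + \<zeta> *s u = z"
    unfolding \<zeta>_def scaleR_eq_vector_smult[symmetric] using r nz by (simp add: u_def)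
  have "norm ((f z - f w) $ j) \<le> (2 * M + 1) / r * norm (z - w)" for j
  proof -
    \<comment> \<open>The numerator is at most 2 M in norm; dividing by 2 M + 1 keeps h strictly
      inside the unit disc even if M = 0. Working by components costs the factor
      \<open>CARD('m)\<close>.\<close>
    define h where "h = (\<lambda>\<zeta>. (f (w + \<zeta> *s u) $ j - f w $ j) / of_real (2 * M + 1))"
    have "h holomorphic_on ball 0 1"
      unfolding holomorphic_on_def
    proof
      fix \<xi> :: complex assume "\<xi> \<in> ball 0 1"
      then have "w + \<xi> *s u \<in> ball w r"
        using line by simp
      then obtain D where D: "Vector_Spaces.linear (*s) (*s) D" "(f has_derivative D) (at (w + \<xi> *s u))"
        using hol[unfolded holomorphic_map_on_open[OF open_ball]] by blast
      have "((\<lambda>\<zeta>. w + \<zeta> *s u) has_derivative (\<lambda>\<zeta>. \<zeta> *s u)) (at \<xi>)"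
        using bounded_linear_imp_has_derivative[OF bounded_linear_vector_smult_left[of u], of "at \<xi>"]
        by (auto intro!: derivative_eq_intros)
      from diff_chain_at[OF this D(2)]
      have "((\<lambda>\<zeta>. f (w + \<zeta> *s u)) has_derivative (\<lambda>\<zeta>. \<zeta> *s D u)) (at \<xi>)"
        using D(1) by (simp add: o_def vec.linear_scale)
      from bounded_linear.has_derivative[OF bounded_linear_vec_nth this, of j]
      have "((\<lambda>\<zeta>. f (w + \<zeta> *s u) $ j) has_field_derivative D u $ j) (at \<xi>)"
        by (simp add: has_field_derivative_def mult_commute_abs)
      then have "(h has_field_derivative (D u $ j - 0) / of_real (2 * M + 1)) (at \<xi>)"
        unfolding h_def by (intro DERIV_cdivide DERIV_diff DERIV_const)
      then show "h field_differentiable at \<xi> within ball 0 1"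
        using field_differentiable_at_within field_differentiable_def by blast
    qed
    moreover have "h 0 = 0"
      by (simp add: h_def)
    moreover have "norm (h \<xi>) < 1" if "norm \<xi> < 1" for \<xi>
    proof -
      have "norm (f (w + \<xi> *s u) $ j - f w $ j) \<le> norm (f (w + \<xi> *s u) $ j) + norm (f w $ j)"
        by (rule norm_triangle_ineq4)
      also have "\<dots> \<le> norm (f (w + \<xi> *s u)) + norm (f w)"
        by (intro add_mono Finite_Cartesian_Product.norm_nth_le)
      also have "\<dots> \<le> M + M"
        using M[OF line[OF that]] M[of w] r by (intro add_mono) auto
      finally have "norm (f (w + \<xi> *s u) $ j - f w $ j) < 2 * M + 1"
        by simp
      moreover have "norm (complex_of_real (2 * M + 1)) = 2 * M + 1"
        unfolding norm_of_real using M0 by simp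
      ultimately show ?thesis
        using M0 unfolding h_def norm_divide by (simp add: divide_less_eq)
    qed
    ultimately have "norm (h \<zeta>) \<le> norm \<zeta>"
      using Schwarz_Lemma(1) \<zeta>(2) by blast
    moreover have "norm (complex_of_real (2 * M + 1)) = 2 * M + 1"
      unfolding norm_of_real using M0 by simp
    then have "norm (h \<zeta>) = norm ((f z - f w) $ j) / (2 * M + 1)"
      unfolding h_def z_eq norm_divide by simp
    ultimately have "norm ((f z - f w) $ j) / (2 * M + 1) \<le> norm (z - w) / r"
      by (simp add: \<zeta>)
    then have "norm ((f z - f w) $ j) \<le> norm (z - w) / r * (2 * M + 1)"
      using M0 by (simp only: pos_divide_le_eq)
    then show ?thesis
      by (simp add: mult.commute)
  qed
  then have "(\<Sum>j\<in>UNIV. norm ((f z - f w) $ j)) \<le> of_nat CARD('m) * ((2 * M + 1) / r * norm (z - w))"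
    by (intro sum_bounded_above) auto
  moreover have "norm (f z - f w) \<le> (\<Sum>j\<in>UNIV. norm ((f z - f w) $ j))"
    unfolding norm_vec_def by (rule L2_set_le_sum) simp
  ultimately show ?thesis
    by (simp add: mult.assoc)
qed simp

subsection \<open>Homeomorphisms intertwining the endomorphisms of two domains\<close>

lemma complex_linear_smult: "Vector_Spaces.linear (*s) (*s) (\<lambda>v :: complex ^ 'n. c *s v)"
  by (simp add: vec.linear_scale_self)

text \<open>On a bounded set D (z - a) is bounded, so a small real multiple of it fits into any
  ball. A real factor is chosen because it commutes with the real-linear derivatives met
  later.\<close>

lemma contraction_into_ball:
  fixes D :: "complex ^ 'n \<Rightarrow> complex ^ 'm"
  assumes "bounded A" and "0 < \<rho>" and "Vector_Spaces.linear (*s) (*s) D"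
  obtains \<epsilon> :: real where "0 < \<epsilon>"
    and "\<And>z. z \<in> A \<Longrightarrow> c + complex_of_real \<epsilon> *s D (z - a) \<in> ball c \<rho>"
proof -
  obtain K where K: "0 < K" "\<And>x. norm (D x) \<le> norm x * K"
    using complex_linear_imp_bounded_linear[OF assms(3)] bounded_linear.pos_bounded by blast
  obtain R where R: "0 < R" "A \<subseteq> ball a R"
    using bounded_subset_ballD[OF assms(1)] by blast
  define \<epsilon> where "\<epsilon> = \<rho> / (R * K)"
  show ?thesis
  proof
    show "0 < \<epsilon>"
      using assms K R by (simp add: \<epsilon>_def)
    fix z assume "z \<in> A"
    then have "norm (z - a) < R"
      using R by (auto simp: dist_norm norm_minus_commute)
    then have "norm (D (z - a)) < R * K"
      using K by (meson K(1) le_less_trans mult_strict_right_mono)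
    then have "\<epsilon> * norm (D (z - a)) < \<epsilon> * (R * K)"
      using \<open>0 < \<epsilon>\<close> by simp
    moreover have "norm (complex_of_real \<epsilon>) = \<epsilon>"
      using \<open>0 < \<epsilon>\<close> by simp
    moreover have "\<epsilon> * (R * K) = \<rho>"
      using R K by (simp add: \<epsilon>_def)
    ultimately have "norm (complex_of_real \<epsilon> *s D (z - a)) < \<rho>"
      by (simp add: norm_vector_smult)
    moreover have "c + v \<in> ball c \<rho> \<longleftrightarrow> norm v < \<rho>" for v
      by (simp add: dist_norm)
    ultimately show "c + complex_of_real \<epsilon> *s D (z - a) \<in> ball c \<rho>"
      by blast
  qed
qed

text \<open>Shrink A into U by a contraction f fixing c. Its conjugate F is continuous, and
  injective because f and \<psi> are, so its image is an open neighbourhood of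
  \<open>\<psi> c\<close> inside the image of U. Invariance of domain is applied to F, which stays
  within one space, so neither continuity of \<psi> nor equality of dimensions enters.\<close>

lemma open_image_intertwiner:
  fixes A :: "(complex ^ 'n) set" and B :: "(complex ^ 'm) set"
  assumes A: "open A" "bounded A" and B: "open B" and bij: "bij_betw \<psi> A B"
    and intertwine: "\<And>f. holomorphic_map_on f A \<Longrightarrow> f \<in> A \<rightarrow> A \<Longrightarrow>
      \<exists>F. holomorphic_map_on F B \<and> F \<in> B \<rightarrow> B \<and> (\<forall>z\<in>A. \<psi> (f z) = F (\<psi> z))"
    and U: "open U" "U \<subseteq> A"
  shows "open (\<psi> ` U)"
proof (subst open_subopen, intro ballI)
  fix w assume "w \<in> \<psi> ` U"
  then obtain c where c: "c \<in> U" "w = \<psi> c"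
    by blast
  then obtain \<rho> where \<rho>: "0 < \<rho>" "ball c \<rho> \<subseteq> U"
    using U openE by blast
  obtain \<epsilon> where \<epsilon>: "0 < \<epsilon>" "\<And>z. z \<in> A \<Longrightarrow> c + complex_of_real \<epsilon> *s id (z - c) \<in> ball c \<rho>"
    using contraction_into_ball[OF A(2) \<rho>(1) vec.linear_id] by blast
  define f where "f = (\<lambda>z. c + complex_of_real \<epsilon> *s (z - c))"
  have fU: "f z \<in> U" if "z \<in> A" for z
    using \<epsilon>(2)[OF that] \<rho>(2) unfolding f_def id_apply by blast
  have "holomorphic_map_on f A"
    unfolding f_def by (rule holomorphic_map_on_affine[OF complex_linear_smult])
  then obtain F where F: "holomorphic_map_on F B" "F \<in> B \<rightarrow> B" "\<And>z. z \<in> A \<Longrightarrow> \<psi> (f z) = F (\<psi> z)"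
    using intertwine fU U(2) by blast
  have psi_A: "\<psi> ` A = B" and inj: "inj_on \<psi> A"
    using bij by (auto simp: bij_betw_def)
  have "inj_on F B"
  proof (rule inj_onI)
    fix u v assume uv: "u \<in> B" "v \<in> B" "F u = F v"
    then obtain x y where xy: "x \<in> A" "u = \<psi> x" "y \<in> A" "v = \<psi> y"
      using psi_A by blast
    then have "\<psi> (f x) = \<psi> (f y)"
      using uv F(3) by simp
    then have "f x = f y"
      using inj fU xy U(2) by (meson inj_onD subsetD)
    then show "u = v"
      using xy \<epsilon>(1) by (simp add: f_def)
  qed
  then have "open (F ` B)"
    by (rule invariance_of_domain[OF holomorphic_map_on_imp_continuous_on[OF F(1)] B])
  moreover have "w \<in> F ` B"
  proof -
    have "\<psi> c = F (\<psi> c)"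
      using F(3)[of c] c U(2) by (auto simp: f_def)
    then show ?thesis
      using c U(2) psi_A by blast
  qed
  moreover have "F ` B \<subseteq> \<psi> ` U"
    using F(3) fU by (force simp flip: psi_A)
  ultimately show "\<exists>T. open T \<and> w \<in> T \<and> T \<subseteq> \<psi> ` U"
    by blast
qed

text \<open>Each f merely has some conjugate F, with no dependence of F on f prescribed; regularity
  in parameters has to come from continuity of \<psi>. The converse relation has by then been spent
  on obtaining that continuity.\<close>

locale intertwiner =
  fixes A :: "(complex ^ 'n) set" and B :: "(complex ^ 'm) set" and \<psi> \<theta>
  assumes A: "is_domain A" "bounded A" and B: "is_domain B" "bounded B"
    and homeo: "homeomorphism A B \<psi> \<theta>"
    and intertwine: "\<And>f. holomorphic_map_on f A \<Longrightarrow> f \<in> A \<rightarrow> A \<Longrightarrow>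
      \<exists>F. holomorphic_map_on F B \<and> F \<in> B \<rightarrow> B \<and> (\<forall>z\<in>A. \<psi> (f z) = F (\<psi> z))"
begin

lemma open_A: "open A" and open_B: "open B"
  using A B by (simp_all add: is_domain_def)

lemma \<theta>_\<psi> [simp]: "z \<in> A \<Longrightarrow> \<theta> (\<psi> z) = z"
  and \<psi>_\<theta> [simp]: "w \<in> B \<Longrightarrow> \<psi> (\<theta> w) = w"
  and \<psi>_in [simp]: "z \<in> A \<Longrightarrow> \<psi> z \<in> B"
  and \<theta>_in [simp]: "w \<in> B \<Longrightarrow> \<theta> w \<in> A"
  and cont_\<psi>: "continuous_on A \<psi>" and cont_\<theta>: "continuous_on B \<theta>"
  using homeo by (auto simp: homeomorphism_def)

lemma isCont_\<psi>: "z \<in> A \<Longrightarrow> isCont \<psi> z"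
  using cont_\<psi> open_A continuous_on_eq_continuous_at by blast

lemma open_image_\<psi>: "open U \<Longrightarrow> U \<subseteq> A \<Longrightarrow> open (\<psi> ` U)"
  using homeomorphism_imp_open_map[OF homeo, of U] open_A open_B
  by (simp add: openin_open_eq)

text \<open>Averaging the conjugates of the contractions \<open>z \<mapsto> a + y + \<epsilon> (z - a)\<close> over the shift \<open>y\<close>
  against a bump function \<open>k\<close> gives a map \<open>I\<close> on \<open>B\<close>, differentiable because each conjugate is
  holomorphic, while \<open>I \<circ> \<psi>\<close> is differentiable because it is a convolution with \<open>k\<close>.  By Sard's
  theorem the derivative of \<open>I\<close> is invertible somewhere, and there \<open>\<psi>\<close> inherits differentiability.\<close>

lemma ex_differentiable: "\<exists>z\<in>A. \<exists>L. (\<psi> has_derivative L) (at z)"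
proof -
  obtain a where a: "a \<in> A"
    using A by (auto simp: is_domain_def)
  then obtain \<rho>' where "0 < \<rho>'" "cball a \<rho>' \<subseteq> A"
    using open_A open_contains_cball by blast
  \<comment> \<open>Twice \<rho>: one for the values of the contraction \<open>f0\<close>, one for
    the shifts y.\<close>
  then obtain \<rho> where \<rho>: "0 < \<rho>" "cball a (2 * \<rho>) \<subseteq> A"
    by (metis field_sum_of_halves half_gt_zero mult_2)
  obtain \<epsilon> where \<epsilon>: "0 < \<epsilon>" "\<And>z. z \<in> A \<Longrightarrow> a + complex_of_real \<epsilon> *s id (z - a) \<in> ball a \<rho>"
    using contraction_into_ball[OF A(2) \<rho>(1) vec.linear_id] by blast
  define f0 where "f0 = (\<lambda>z. a + complex_of_real \<epsilon> *s (z - a))"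
  have f0_hol: "holomorphic_map_on f0 A"
    unfolding f0_def by (rule holomorphic_map_on_affine[OF complex_linear_smult])
  have f0_ball: "f0 z \<in> ball a \<rho>" if "z \<in> A" for z
    using \<epsilon>(2)[OF that] unfolding f0_def id_apply .
  have shift_A: "x + y \<in> cball a (2 * \<rho>)" if "x \<in> ball a \<rho>" "norm y \<le> \<rho>" for x y
    using that norm_triangle_ineq[of "x - a" y]
    by (simp add: dist_norm norm_minus_commute[of a] add_diff_eq[symmetric] diff_add_eq)
  have "open (f0 ` A)"
    by (rule invariance_of_domain[OF holomorphic_map_on_imp_continuous_on[OF f0_hol] open_A])
      (use \<epsilon>(1) in \<open>auto simp: inj_on_def f0_def\<close>)
  moreover have f0_A: "f0 ` A \<subseteq> A"
    using f0_ball \<rho> by fastforce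
  ultimately have "open (\<psi> ` f0 ` A)"
    by (rule open_image_\<psi>)
  moreover have "\<psi> a \<in> \<psi> ` f0 ` A"
  proof -
    have "f0 a = a"
      by (simp add: f0_def)
    then show ?thesis
      using a by (metis imageI)
  qed
  \<comment> \<open>On this ball \<theta> takes values in the image of \<open>f0\<close>, where the
    smoothed map can be expressed through \<open>I\<close>. The scale \<delta> below is chosen so
    that smoothing moves \<psi> by at most r / 2, the tolerance in the Brouwer argument.\<close>
  ultimately obtain r where r: "0 < r" "cball (\<psi> a) r \<subseteq> \<psi> ` f0 ` A"
    using open_contains_cball by blast
  have "uniformly_continuous_on (cball a (2 * \<rho>)) \<psi>"
    by (intro compact_uniformly_continuous continuous_on_subset[OF cont_\<psi>] \<rho>) simp
  then obtain \<delta>' where \<delta>': "0 < \<delta>'"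
    "\<And>x x'. x \<in> cball a (2 * \<rho>) \<Longrightarrow> x' \<in> cball a (2 * \<rho>) \<Longrightarrow> dist x' x < \<delta>' \<Longrightarrow> dist (\<psi> x') (\<psi> x) < r / 2"
    unfolding uniformly_continuous_on_def using r(1) half_gt_zero by metis
  define \<delta> where "\<delta> = min \<delta>' \<rho>"
  have \<delta>: "0 < \<delta>" "\<delta> \<le> \<delta>'" "\<delta> \<le> \<rho>"
    using \<delta>'(1) \<rho>(1) by (simp_all add: \<delta>_def)
  obtain k :: "complex ^ 'n \<Rightarrow> real" where k: "\<And>x. 0 \<le> k x" "\<And>x. \<delta> \<le> norm x \<Longrightarrow> k x = 0"
    "\<And>x. k differentiable (at x)"
    "\<And>R. \<exists>C. \<forall>x y. norm x \<le> R \<longrightarrow> norm y \<le> R \<longrightarrow> \<bar>k x - k y\<bar> \<le> C * norm (x - y)"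
    "continuous_on UNIV k" "integrable lborel k" "(\<integral>x. k x \<partial>lborel) = 1"
    using exists_bump[OF \<delta>(1)] by metis
  have [measurable]: "k \<in> borel_measurable borel"
    using k(5) by (rule borel_measurable_continuous_onI)
  \<comment> \<open>Extension by zero gives a bounded measurable map on the whole space, so
    translation of the integration variable is free.\<close>
  define \<psi>0 where "\<psi>0 = (\<lambda>y. indicator A y *\<^sub>R \<psi> y)"
  have [measurable]: "\<psi>0 \<in> borel_measurable borel"
    unfolding \<psi>0_def by (rule borel_measurable_continuous_on_indicator) (use open_A cont_\<psi> in auto)
  have \<psi>0: "\<psi>0 y = \<psi> y" if "y \<in> A" for y
    using that by (simp add: \<psi>0_def)
  obtain M where M: "0 < M" "\<And>w. w \<in> B \<Longrightarrow> norm w \<le> M"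
    using B(2) bounded_pos by blast
  have M\<psi>0: "norm (\<psi>0 y) \<le> M" for y
    using M by (cases "y \<in> A") (simp_all add: \<psi>0_def)
  have k\<psi>0: "norm (k x *\<^sub>R \<psi>0 y) \<le> M * k x" for x y
    using mult_right_mono[OF M\<psi>0[of y] k(1)[of x]] k(1)[of x] by (simp add: mult.commute)
  have int_k: "integrable lborel (\<lambda>y. k (y - u))" for u
  proof -
    have "integrable (distr lborel borel ((+) (- u))) k"
      unfolding lborel_distr_plus by (rule k(6))
    then show ?thesis
      by (simp add: integrable_distr_eq)
  qed
  have int_bnd: "integrable lborel g" if [measurable]: "g \<in> borel_measurable borel"
    and "\<And>y. norm (g y) \<le> M * k (y - u)" for g :: "complex ^ 'n \<Rightarrow> complex ^ 'm" and u
  proof (rule Bochner_Integration.integrable_bound)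
    show "integrable lborel (\<lambda>y. M * k (y - u))"
      using int_k by simp
    show "AE y in lborel. norm (g y) \<le> norm (M * k (y - u))"
      using that(2) M(1) k(1) by (intro AE_I2) (simp add: abs_mult)
  qed simp
  \<comment> \<open>In this form the integrand matches the conjugates of the shifted contractions.
    In the form \<open>P_eq\<close> the variable u occurs only in the kernel, so P is differentiable
    although \<psi> is only continuous.\<close>
  define P where "P = (\<lambda>u. \<integral>y. k y *\<^sub>R \<psi>0 (u + y) \<partial>lborel)"
  have P_eq: "P u = (\<integral>y. k (y - u) *\<^sub>R \<psi>0 y \<partial>lborel)" for u
  proof -
    have "(\<integral>y. k (y - u) *\<^sub>R \<psi>0 y \<partial>lborel) = (\<integral>y. k (y - u) *\<^sub>R \<psi>0 y \<partial>distr lborel borel ((+) u))"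
      unfolding lborel_distr_plus ..
    also have "\<dots> = P u"
      unfolding P_def by (subst integral_distr) auto
    finally show ?thesis
      by simp
  qed
  have int_P: "integrable lborel (\<lambda>y. k y *\<^sub>R \<psi>0 (u + y))" for u
  proof (rule int_bnd[where u = 0])
    show "norm (k y *\<^sub>R \<psi>0 (u + y)) \<le> M * k (y - 0)" for y
      using k\<psi>0 by simp
  qed measurable
  have P_diff: "\<exists>D. (P has_derivative D) (at u0)" for u0
  proof -
    obtain kd where kd: "\<And>x. (k has_derivative kd x) (at x)"
      using k(3) unfolding differentiable_def by metis
    obtain R0 where R0: "\<And>y. y \<in> A \<Longrightarrow> norm y \<le> R0"
      using A(2) bounded_iff by blast
    \<comment> \<open>Bounds y - u for y in A and u in the unit ball around
      \<open>u0\<close>.\<close>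
    define R where "R = R0 + norm u0 + 1"
    obtain C where C: "\<And>x y. norm x \<le> R \<Longrightarrow> norm y \<le> R \<Longrightarrow> \<bar>k x - k y\<bar> \<le> C * norm (x - y)"
      using k(4) by blast
    have "((\<lambda>u. \<integral>y. k (y - u) *\<^sub>R \<psi>0 y \<partial>lborel) has_derivative
      (\<lambda>h. \<integral>y. kd (y - u0) (- h) *\<^sub>R \<psi>0 y \<partial>lborel)) (at u0)"
    proof (rule has_derivative_integral_dominated[where S = "ball u0 1" and K = "\<lambda>y. C * M * indicator A y"])
      show "integrable lborel (\<lambda>y. k (y - u) *\<^sub>R \<psi>0 y)" for u
      proof (rule int_bnd)
        show "norm (k (y - u) *\<^sub>R \<psi>0 y) \<le> M * k (y - u)" for y
          by (rule k\<psi>0)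
      qed measurable
      show "((\<lambda>u. k (y - u) *\<^sub>R \<psi>0 y) has_derivative (\<lambda>h. kd (y - u0) (- h) *\<^sub>R \<psi>0 y)) (at u0)" for y
      proof -
        have "((\<lambda>u. y - u) has_derivative (\<lambda>h. - h)) (at u0)"
          by (auto intro!: derivative_eq_intros)
        from diff_chain_at[OF this kd]
        have "((\<lambda>u. k (y - u)) has_derivative (\<lambda>h. kd (y - u0) (- h))) (at u0)"
          by (simp add: o_def)
        then show ?thesis
          by (rule has_derivative_scaleR_left)
      qed
      show "norm (k (y - u) *\<^sub>R \<psi>0 y - k (y - u0) *\<^sub>R \<psi>0 y) \<le> C * M * indicator A y * norm (u - u0)"
        if u: "u \<in> ball u0 1" for u y
      proof (cases "y \<in> A")
        case True
        have "norm u \<le> norm u0 + 1"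
          using u norm_triangle_ineq2[of u u0] by (simp add: dist_norm norm_minus_commute)
        then have "norm (y - u) \<le> R" "norm (y - u0) \<le> R"
          using R0[OF True] norm_triangle_ineq4[of y u] norm_triangle_ineq4[of y u0] by (simp_all add: R_def)
        from C[OF this] have "\<bar>k (y - u) - k (y - u0)\<bar> \<le> C * norm (u - u0)"
          by (simp add: norm_minus_commute)
        then have "\<bar>k (y - u) - k (y - u0)\<bar> * norm (\<psi>0 y) \<le> (C * norm (u - u0)) * M"
          using M\<psi>0 by (intro mult_mono) auto
        then show ?thesis
          using True by (simp add: mult_ac flip: scaleR_diff_left)
      qed (simp add: \<psi>0_def)
      show "integrable lborel (\<lambda>y. C * M * indicator A y)"
        using emeasure_bounded_finite[OF A(2)] open_A by (intro integrable_mult_right) simp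
    qed simp_all
    then show ?thesis
      unfolding P_eq[abs_def] by blast
  qed
  have P_near: "norm (P x - \<psi> x) \<le> r / 2" if x: "x \<in> ball a \<rho>" for x
  proof -
    have bnd: "norm (k y *\<^sub>R (\<psi>0 (x + y) - \<psi> x)) \<le> r / 2 * k y" for y
    proof (cases "norm y < \<delta>")
      case True
      then have "x + y \<in> cball a (2 * \<rho>)" "x \<in> cball a (2 * \<rho>)" "dist (x + y) x < \<delta>'"
        using shift_A[OF x, of y] shift_A[OF x, of 0] \<delta> \<rho>(1) by (auto simp: dist_norm)
      then have "norm (\<psi>0 (x + y) - \<psi> x) \<le> r / 2"
        using \<delta>'(2) \<rho>(2) \<psi>0 by (metis dist_norm less_imp_le subsetD)
      then have "k y * norm (\<psi>0 (x + y) - \<psi> x) \<le> k y * (r / 2)"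
        using k(1) by (rule mult_left_mono)
      then show ?thesis
        using k(1)[of y] by (simp add: mult.commute)
    qed (simp add: k(2))
    have "P x - \<psi> x = (\<integral>y. k y *\<^sub>R \<psi>0 (x + y) \<partial>lborel) - (\<integral>y. k y *\<^sub>R \<psi> x \<partial>lborel)"
      using k(6,7) by (simp add: P_def)
    also have "\<dots> = (\<integral>y. k y *\<^sub>R (\<psi>0 (x + y) - \<psi> x) \<partial>lborel)"
      using int_P k(6) by (simp add: scaleR_diff_right)
    finally have "norm (P x - \<psi> x) = norm (\<integral>y. k y *\<^sub>R (\<psi>0 (x + y) - \<psi> x) \<partial>lborel)"
      by simp
    also have "\<dots> \<le> (\<integral>y. r / 2 * k y \<partial>lborel)"
      by (rule Bochner_Integration.integral_norm_bound_integral)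
        (use int_P k(6) bnd in \<open>simp_all add: scaleR_diff_right\<close>)
    finally show ?thesis
      using k(7) by simp
  qed
  \<comment> \<open>On B this is the mean of the holomorphic maps \<open>F y\<close> with weight k,
    by \<open>F_eq\<close> below; and \<open>I (\<psi> z)\<close> equals \<open>P (f0 z)\<close> on
    A.\<close>
  define I where "I = (\<lambda>w. P (f0 (\<theta> w)))"
  have "\<exists>F. holomorphic_map_on F B \<and> F \<in> B \<rightarrow> B \<and> (\<forall>z\<in>A. \<psi> (f0 z + y) = F (\<psi> z))"
    if "norm y < \<delta>" for y
  proof (rule intertwine)
    have "holomorphic_map_on (\<lambda>z. (a + y) + complex_of_real \<epsilon> *s (z - a)) A"
      by (rule holomorphic_map_on_affine[OF complex_linear_smult])
    then show "holomorphic_map_on (\<lambda>z. f0 z + y) A"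
      by (simp add: f0_def algebra_simps)
    show "(\<lambda>z. f0 z + y) \<in> A \<rightarrow> A"
      using shift_A[OF f0_ball] that \<delta> \<rho>(2) by fastforce
  qed
  then obtain F where F: "\<And>y. norm y < \<delta> \<Longrightarrow> holomorphic_map_on (F y) B"
    "\<And>y. norm y < \<delta> \<Longrightarrow> F y \<in> B \<rightarrow> B"
    "\<And>y z. norm y < \<delta> \<Longrightarrow> z \<in> A \<Longrightarrow> \<psi> (f0 z + y) = F y (\<psi> z)"
    by metis
  have F_eq: "\<psi>0 (f0 (\<theta> w) + y) = F y w" if "norm y < \<delta>" "w \<in> B" for w y
  proof -
    have "f0 (\<theta> w) + y \<in> A"
      using shift_A[OF f0_ball, of "\<theta> w" y] that \<delta> \<rho>(2) by auto
    then show ?thesis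
      using F(3)[of y "\<theta> w"] that by (simp add: \<psi>0)
  qed
  have I_diff: "\<exists>D. (I has_derivative D) (at w0)" if w0: "w0 \<in> B" for w0
  proof -
    have "\<forall>y. \<exists>D. norm y < \<delta> \<longrightarrow> (F y has_derivative D) (at w0)"
      using F(1) w0 unfolding holomorphic_map_on_open[OF open_B] by blast
    then obtain FD where FD: "\<And>y. norm y < \<delta> \<Longrightarrow> (F y has_derivative FD y) (at w0)"
      by metis
    obtain s where s: "0 < s" "ball w0 s \<subseteq> B"
      using open_B w0 openE by blast
    \<comment> \<open>All \<open>F y\<close> with norm y < \<delta> map into B, hence are bounded by
      M, so the Schwarz estimate gives one Lipschitz constant at \<open>w0\<close> for all of
      them.\<close>
    define C where "C = CARD('m) * ((2 * M + 1) / s)"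
    \<comment> \<open>For larger y nothing is known about \<open>F y\<close> and
      \<open>FD y\<close>, but k vanishes there.\<close>
    define g' where "g' = (\<lambda>y h. if norm y < \<delta> then k y *\<^sub>R FD y h else 0)"
    have "((\<lambda>w. \<integral>y. k y *\<^sub>R \<psi>0 (f0 (\<theta> w) + y) \<partial>lborel) has_derivative
      (\<lambda>h. \<integral>y. g' y h \<partial>lborel)) (at w0)"
    proof (rule has_derivative_integral_dominated[where S = "ball w0 s" and K = "\<lambda>y. C * k y"])
      show "integrable lborel (\<lambda>y. k y *\<^sub>R \<psi>0 (f0 (\<theta> w) + y))" for w
        by (rule int_P)
      show "((\<lambda>w. k y *\<^sub>R \<psi>0 (f0 (\<theta> w) + y)) has_derivative g' y) (at w0)" for y
      proof (cases "norm y < \<delta>")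
        case True
        have "((\<lambda>w. k y *\<^sub>R F y w) has_derivative (\<lambda>h. k y *\<^sub>R FD y h)) (at w0)"
          using FD[OF True] by (rule has_derivative_scaleR_right)
        then have "((\<lambda>w. k y *\<^sub>R \<psi>0 (f0 (\<theta> w) + y)) has_derivative (\<lambda>h. k y *\<^sub>R FD y h)) (at w0)"
          by (rule has_derivative_transform_within_open[OF _ open_B w0]) (simp add: F_eq[OF True])
        then show ?thesis
          using True by (simp add: g'_def)
      qed (simp add: g'_def k(2))
      show "norm (k y *\<^sub>R \<psi>0 (f0 (\<theta> w) + y) - k y *\<^sub>R \<psi>0 (f0 (\<theta> w0) + y)) \<le> C * k y * norm (w - w0)"
        if w: "w \<in> ball w0 s" for w y
      proof (cases "norm y < \<delta>")
        case True
        have "norm (F y w - F y w0) \<le> C * norm (w - w0)"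
          unfolding C_def
        proof (rule holomorphic_map_on_lipschitz_at)
          show "holomorphic_map_on (F y) (ball w0 s)"
            using F(1)[OF True] s(2) unfolding holomorphic_map_on_open[OF open_B] holomorphic_map_on_open[OF open_ball]
            by blast
          show "norm (F y z) \<le> M" if "z \<in> ball w0 s" for z
            using F(2)[OF True] s(2) M(2) that by blast
        qed fact
        then have "k y * norm (F y w - F y w0) \<le> k y * (C * norm (w - w0))"
          using k(1) by (rule mult_left_mono)
        moreover have "w \<in> B"
          using w s(2) by blast
        ultimately show ?thesis
          using True w0 k(1) by (simp add: F_eq mult_ac flip: scaleR_diff_right)
      qed (simp add: k(2))
      show "integrable lborel (\<lambda>y. C * k y)"
        using k(6) by simp
    qed (use s in simp_all)
    then show ?thesis
      unfolding I_def P_def by blast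
  qed
  then obtain I' where I': "\<And>w. w \<in> B \<Longrightarrow> (I has_derivative I' w) (at w)"
    by metis
  \<comment> \<open>Otherwise the image of B under \<open>I\<close> would be negligible. It contains
    the image of a closed ball under P after \<theta>, a map r / 2 close to the identity, and hence
    a ball.\<close>
  have "\<exists>w\<in>B. inj (I' w)"
  proof (rule ccontr)
    assume "\<not> (\<exists>w\<in>B. inj (I' w))"
    then have neg: "negligible (I ` B)"
      using negligible_image_singular_derivative[of B I I'] I' by blast
    have \<theta>_sub: "\<theta> u \<in> f0 ` A" if "u \<in> cball (\<psi> a) r" for u
      using that r(2) f0_A \<theta>_\<psi> by fastforce
    have "ball (\<psi> a) (r / 2) \<subseteq> (\<lambda>u. P (\<theta> u)) ` cball (\<psi> a) r"
    proof (rule ball_subset_perturbed_identity_image[OF r(1)])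
      have sub: "cball (\<psi> a) r \<subseteq> B"
        using r(2) f0_A \<psi>_in by blast
      have "continuous_on UNIV P"
        using P_diff has_derivative_continuous continuous_at_imp_continuous_on by blast
      then show "continuous_on (cball (\<psi> a) r) (\<lambda>u. P (\<theta> u))"
        using continuous_on_compose2[OF _ continuous_on_subset[OF cont_\<theta> sub]] by blast
      show "norm (P (\<theta> u) - u) \<le> r / 2" if u: "u \<in> cball (\<psi> a) r" for u
      proof -
        obtain z where "z \<in> A" "\<theta> u = f0 z"
          using \<theta>_sub[OF u] by (rule imageE)
        then have "\<theta> u \<in> ball a \<rho>"
          using f0_ball[of z] by simp
        moreover have "\<psi> (\<theta> u) = u"
          using u sub \<psi>_\<theta> by blast
        ultimately show ?thesis
          using P_near[of "\<theta> u"] by simp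
      qed
    qed
    also have "\<dots> \<subseteq> I ` B"
    proof
      fix v assume "v \<in> (\<lambda>u. P (\<theta> u)) ` cball (\<psi> a) r"
      then obtain u where u: "u \<in> cball (\<psi> a) r" "v = P (\<theta> u)"
        by blast
      obtain z where "z \<in> A" "\<theta> u = f0 z"
        using \<theta>_sub[OF u(1)] by (rule imageE)
      with u have "z \<in> A" "v = P (f0 z)"
        by simp_all
      then have "v = I (\<psi> z)" "\<psi> z \<in> B"
        by (simp_all add: I_def)
      then show "v \<in> I ` B"
        by blast
    qed
    finally have "negligible (ball (\<psi> a) (r / 2))"
      using neg negligible_subset by blast
    then show False
      using open_not_negligible[of "ball (\<psi> a) (r / 2)"] r(1) by simp
  qed
  then obtain w0 where w0: "w0 \<in> B" "inj (I' w0)"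
    by blast
  obtain D where D: "(f0 has_derivative D) (at (\<theta> w0))"
    using f0_hol w0(1) unfolding holomorphic_map_on_open[OF open_A] by (meson \<theta>_in)
  obtain E where "(P has_derivative E) (at (f0 (\<theta> w0)))"
    using P_diff by blast
  from diff_chain_at[OF D this] have "((\<lambda>z. P (f0 z)) has_derivative E \<circ> D) (at (\<theta> w0))"
    by (simp add: o_def)
  then have "((\<lambda>z. I (\<psi> z)) has_derivative E \<circ> D) (at (\<theta> w0))"
    by (rule has_derivative_transform_within_open[OF _ open_A]) (use w0 in \<open>simp_all add: I_def\<close>)
  moreover have "(I has_derivative I' w0) (at (\<psi> (\<theta> w0)))"
    using I' w0 by simp
  moreover have "isCont \<psi> (\<theta> w0)"
    using w0(1) by (intro isCont_\<psi>) simp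
  ultimately have "\<exists>L. (\<psi> has_derivative L) (at (\<theta> w0))"
    using differentiable_cancel_left w0(2) by blast
  then show ?thesis
    using w0(1) by (meson \<theta>_in)
qed

end

section \<open>Real-linear maps that intertwine complex-linear endomorphisms\<close>

lemma complex_linear_iff:
  fixes L :: "complex ^ 'n \<Rightarrow> complex ^ 'm"
  shows "Vector_Spaces.linear (*s) (*s) L \<longleftrightarrow> linear L \<and> (\<forall>v. L (\<i> *s v) = \<i> *s L v)"
proof
  assume lin: "Vector_Spaces.linear (*s) (*s) L"
  then show "linear L \<and> (\<forall>v. L (\<i> *s v) = \<i> *s L v)"
    using complex_linear_imp_bounded_linear[OF lin] bounded_linear.linear vec.linear_scale by blast
next
  assume L: "linear L \<and> (\<forall>v. L (\<i> *s v) = \<i> *s L v)"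
  have "L (c *s v) = c *s L v" for c v
  proof -
    have split: "c *s x = Re c *\<^sub>R x + Im c *\<^sub>R (\<i> *s x)" for x :: "complex ^ 'k"
    proof -
      have "c = of_real (Re c) + of_real (Im c) * \<i>"
        using complex_eq[of c] by (simp add: mult.commute)
      then have "c *s x = of_real (Re c) *s x + (of_real (Im c) * \<i>) *s x"
        by (metis vector_sadd_rdistrib)
      then show ?thesis
        by (simp add: scaleR_eq_vector_smult vector_smult_assoc)
    qed
    show ?thesis
      unfolding split using L by (simp add: linear_add linear_scale)
  qed
  then show "Vector_Spaces.linear (*s) (*s) L"
    using L by (simp add: Vector_Spaces.linear_iff linear_add vec.vector_space_axioms)
qed

lemma complex_linear_rank_one:
  "Vector_Spaces.linear (*s) (*s) (\<lambda>v :: complex ^ 'n. (v $ j) *s (x :: complex ^ 'm))"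
  by (simp add: Vector_Spaces.linear_iff vec.vector_space_axioms vector_sadd_rdistrib vector_smult_assoc)

text \<open>A Schur-type argument: a rank-one map carries a nonzero kernel vector x to any v, and
  then L v = G (L x) = 0.\<close>

lemma intertwining_complex_endomorphisms_zero_or_inj:
  fixes L :: "complex ^ 'n \<Rightarrow> complex ^ 'm"
  assumes "linear L"
    and comm: "\<And>D :: complex ^ 'n \<Rightarrow> complex ^ 'n. Vector_Spaces.linear (*s) (*s) D \<Longrightarrow>
      \<exists>G. Vector_Spaces.linear (*s) (*s) G \<and> (\<forall>v. L (D v) = G (L v))"
  shows "(\<forall>v. L v = 0) \<or> inj L"
proof (rule disjCI)
  assume "\<not> inj L"
  then obtain x where x: "L x = 0" "x \<noteq> 0"
    using linear_injective_0[OF assms(1)] by blast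
  then obtain j where j: "x $ j \<noteq> 0"
    by (auto simp: vec_eq_iff)
  show "\<forall>v. L v = 0"
  proof
    fix v
    obtain G where G: "Vector_Spaces.linear (*s) (*s) G" "\<And>u. L ((u $ j) *s (inverse (x $ j) *s v)) = G (L u)"
      using comm[OF complex_linear_rank_one] by blast
    have "L v = G (L x)"
      using G(2)[of x] j by (simp add: vector_smult_assoc)
    then show "L v = 0"
      using G(1) x by (simp add: vec.linear_0)
  qed
qed

text \<open>\<open>K = L\<^sup>-\<^sup>1 \<circ> \<i> \<circ> L\<close> commutes with every complex-linear map, hence is a scalar, whose square is \<open>-1\<close>.\<close>

lemma intertwining_complex_endomorphisms_linear_or_antilinear:
  fixes L :: "complex ^ 'n \<Rightarrow> complex ^ 'm"
  assumes lin: "linear L" and bij: "bij L"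
    and comm: "\<And>D :: complex ^ 'n \<Rightarrow> complex ^ 'n. Vector_Spaces.linear (*s) (*s) D \<Longrightarrow>
      \<exists>G. Vector_Spaces.linear (*s) (*s) G \<and> (\<forall>v. L (D v) = G (L v))"
  shows "(\<forall>v. L (\<i> *s v) = \<i> *s L v) \<or> (\<forall>v. L (\<i> *s v) = - (\<i> *s L v))"
proof -
  define K where "K = (\<lambda>v. inv_into UNIV L (\<i> *s L v))"
  have LK: "L (K v) = \<i> *s L v" for v
    unfolding K_def by (rule surj_f_inv_f[OF bij_is_surj[OF bij]])
  have inj: "L u = L v \<Longrightarrow> u = v" for u v
    using bij by (meson bij_is_inj injD)
  have KD: "K (D v) = D (K v)" if D: "Vector_Spaces.linear (*s) (*s) D" for D v
  proof -
    obtain G where G: "Vector_Spaces.linear (*s) (*s) G" "\<And>u. L (D u) = G (L u)"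
      using comm[OF D] by blast
    have "L (K (D v)) = L (D (K v))"
      using G by (simp add: LK vec.linear_scale)
    then show ?thesis
      by (rule inj)
  qed
  obtain j :: 'n where True
    by simp
  define e where "e = (axis j 1 :: complex ^ 'n)"
  define c where "c = K e $ j"
  \<comment> \<open>The rank-one map with direction x sends e to x, and K commutes with it, so K x
    is the j-th coordinate of K e times x.\<close>
  have K: "K x = c *s x" for x
    using KD[OF complex_linear_rank_one[of j x], of e] by (simp add: e_def c_def)
  have "K (K e) = - e"
  proof (rule inj)
    have "L (K (K e)) = \<i> *s (\<i> *s L e)"
      by (simp add: LK)
    also have "\<dots> = - L e"
      by (simp add: vector_smult_assoc vec_eq_iff)
    also have "\<dots> = L (- e)"
      using lin by (simp add: linear_neg)
    finally show "L (K (K e)) = L (- e)" .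
  qed
  then have "(c *s (c *s e)) $ j = (- e) $ j"
    by (simp only: K)
  then have "c * c = - 1"
    by (simp add: e_def)
  then have "(c - \<i>) * (c + \<i>) = 0"
    by (simp add: algebra_simps)
  then consider "c = \<i>" | "c = - \<i>"
    by (auto simp: eq_neg_iff_add_eq_0)
  then show ?thesis
  proof cases
    case 1
    then show ?thesis
      using LK by (simp add: K)
  next
    case 2
    have "L (\<i> *s v) = - (\<i> *s L v)" for v
    proof -
      have "\<i> *s v = - K v"
        using 2 by (simp add: K vec_eq_iff)
      then show ?thesis
        using LK[of v] lin by (simp add: linear_neg)
    qed
    then show ?thesis
      by blast
  qed
qed

text \<open>Continuity of h allows the inverse to be differentiated point by point, with the inverse
  of a complex-linear bijection as its derivative.\<close>

lemma biholomorphicI: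
  fixes f :: "complex ^ 'n \<Rightarrow> complex ^ 'm"
  assumes A: "open A" and C: "open C" and homeo: "homeomorphism A C f h"
    and der: "\<And>z. z \<in> A \<Longrightarrow> \<exists>L. (f has_derivative L) (at z) \<and> bij L \<and> Vector_Spaces.linear (*s) (*s) L"
  shows "biholomorphic f A C"
proof -
  have hom: "f ` A = C" "h ` C = A" "\<And>z. z \<in> A \<Longrightarrow> h (f z) = z" "\<And>w. w \<in> C \<Longrightarrow> f (h w) = w"
    "continuous_on C h"
    using homeo by (auto simp: homeomorphism_def)
  have inj: "inj_on f A"
    using hom(3) by (metis inj_onI)
  have "holomorphic_map_on f A"
    unfolding holomorphic_map_on_open[OF A] using der by blast
  moreover have "holomorphic_map_on h C"
    unfolding holomorphic_map_on_open[OF C]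
  proof
    fix w assume w: "w \<in> C"
    then obtain L where L: "(f has_derivative L) (at (h w))" "bij L" "Vector_Spaces.linear (*s) (*s) L"
      using der hom(2) by blast
    have LL: "L (inv_into UNIV L u) = u" for u
      using L(2) by (simp add: bij_is_surj surj_f_inv_f)
    have Linj: "L u = L v \<Longrightarrow> u = v" for u v
      using L(2) by (meson bij_is_inj injD)
    have inv_lin: "Vector_Spaces.linear (*s) (*s) (inv_into UNIV L)"
      unfolding Vector_Spaces.linear_iff
    proof (intro conjI allI vec.vector_space_axioms)
      show "inv_into UNIV L (x + y) = inv_into UNIV L x + inv_into UNIV L y" for x y
        by (rule Linj) (simp add: LL vec.linear_add[OF L(3)])
      show "inv_into UNIV L (c *s x) = c *s inv_into UNIV L x" for c x
        by (rule Linj) (simp add: LL vec.linear_scale[OF L(3)])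
    qed
    moreover have "(h has_derivative inv_into UNIV L) (at w)"
    proof (rule has_derivative_inverse_basic[where T = C])
      show "bounded_linear (inv_into UNIV L)"
        by (rule complex_linear_imp_bounded_linear[OF inv_lin])
      show "inv_into UNIV L \<circ> L = id"
        using L(2) by (simp add: bij_is_inj)
      show "continuous (at w) h"
        using hom(5) C w continuous_on_eq_continuous_at by blast
    qed (fact L(1) C w hom(4))+
    ultimately show "\<exists>D. Vector_Spaces.linear (*s) (*s) D \<and> (h has_derivative D) (at w)"
      by blast
  qed
  then have "holomorphic_map_on (inv_into A f) C"
    by (rule holomorphic_map_on_cong) (use hom inj in \<open>auto simp: inv_into_f_f\<close>)
  ultimately show ?thesis
    using hom(1) inj by (simp add: biholomorphic_def bij_betw_def)
qed

lemma vec_cnj_vec_cnj [simp]: "vec_cnj (vec_cnj z) = z"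
  by (simp add: vec_cnj_def vec_eq_iff)

lemma vec_cnj_smult: "vec_cnj (c *s z) = cnj c *s vec_cnj z"
  by (simp add: vec_cnj_def vec_eq_iff)

lemma bounded_linear_vec_cnj: "bounded_linear vec_cnj"
  unfolding linear_conv_bounded_linear[symmetric]
  by (rule linearI) (simp_all add: vec_cnj_def vec_eq_iff)

lemma bij_vec_cnj: "bij vec_cnj"
  by (rule o_bij[of vec_cnj]) (simp_all add: fun_eq_iff)

lemma homeomorphism_vec_cnj: "homeomorphism S (vec_cnj ` S) vec_cnj vec_cnj"
  using linear_continuous_on[OF bounded_linear_vec_cnj]
  by (auto simp: homeomorphism_def image_image)

lemma open_image_vec_cnj:
  assumes "open S"
  shows "open (vec_cnj ` S)"
proof -
  have "vec_cnj ` S = vec_cnj -` S"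
    by (auto simp: image_iff) (metis vec_cnj_vec_cnj)
  then show ?thesis
    using continuous_open_vimage[OF assms] bounded_linear_vec_cnj linear_continuous_at by metis
qed

section \<open>The derivative of \<psi> at all points and the resulting alternative\<close>

context intertwiner
begin

lemma CARD_eq: "CARD('n) = CARD('m)"
proof -
  have "DIM(complex ^ 'n) \<le> DIM(complex ^ 'm)"
  proof (rule invariance_of_dimension[OF cont_\<psi> open_A])
    show "inj_on \<psi> A"
      by (metis \<theta>_\<psi> inj_onI)
  qed (use A in \<open>simp add: is_domain_def\<close>)
  moreover have "DIM(complex ^ 'm) \<le> DIM(complex ^ 'n)"
  proof (rule invariance_of_dimension[OF cont_\<theta> open_B])
    show "inj_on \<theta> B"
      by (metis \<psi>_\<theta> inj_onI)
  qed (use B in \<open>simp add: is_domain_def\<close>)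
  ultimately show ?thesis
    by simp
qed

lemma ex_affine_intertwined:
  assumes "z1 \<in> A" and D: "Vector_Spaces.linear (*s) (*s) D"
  obtains \<epsilon> F where "0 < \<epsilon>" and "holomorphic_map_on F B"
    and "\<And>z. z \<in> A \<Longrightarrow> \<psi> (z1 + complex_of_real \<epsilon> *s D (z - z0)) = F (\<psi> z)"
proof -
  obtain \<rho> where \<rho>: "0 < \<rho>" "ball z1 \<rho> \<subseteq> A"
    using open_A assms(1) openE by blast
  obtain \<epsilon> where \<epsilon>: "0 < \<epsilon>" "\<And>z. z \<in> A \<Longrightarrow> z1 + complex_of_real \<epsilon> *s D (z - z0) \<in> ball z1 \<rho>"
    using contraction_into_ball[OF A(2) \<rho>(1) D] by metis
  have "holomorphic_map_on (\<lambda>z. z1 + complex_of_real \<epsilon> *s D (z - z0)) A"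
    by (rule holomorphic_map_on_affine[OF vec.linear_compose_scale_right[OF D]])
  moreover have "(\<lambda>z. z1 + complex_of_real \<epsilon> *s D (z - z0)) \<in> A \<rightarrow> A"
    using \<epsilon>(2) \<rho>(2) by blast
  ultimately show ?thesis
    using intertwine \<epsilon>(1) that by blast
qed

text \<open>Near \<open>z1\<close>, \<psi> is F after \<psi> after h, where h inverts a contraction
  that sends \<open>z0\<close> to \<open>z1\<close> and F is the conjugate of that contraction. The
  derivative changes only by a complex-linear factor on the left, so linearity or antilinearity at
  one point spreads to all.\<close>

lemma derivative_transport:
  assumes "z0 \<in> A" and L: "(\<psi> has_derivative L) (at z0)" and "z1 \<in> A"
  shows "\<exists>G. Vector_Spaces.linear (*s) (*s) G \<and> (\<psi> has_derivative G \<circ> L) (at z1)"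
proof -
  obtain \<epsilon> F where \<epsilon>: "0 < \<epsilon>" and F: "holomorphic_map_on F B"
    "\<And>z. z \<in> A \<Longrightarrow> \<psi> (z1 + complex_of_real \<epsilon> *s id (z - z0)) = F (\<psi> z)"
    using ex_affine_intertwined[OF assms(3) vec.linear_id] by metis
  define h where "h = (\<lambda>z. z0 + inverse \<epsilon> *\<^sub>R (z - z1))"
  have h_z1: "h z1 = z0"
    by (simp add: h_def)
  have h': "(h has_derivative (\<lambda>v. inverse \<epsilon> *\<^sub>R v)) (at z1)"
    unfolding h_def by (auto intro!: derivative_eq_intros)
  obtain F' where F': "Vector_Spaces.linear (*s) (*s) F'" "(F has_derivative F') (at (\<psi> z0))"
    using F(1) assms(1) unfolding holomorphic_map_on_open[OF open_B] by (meson \<psi>_in)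
  \<comment> \<open>The factor of h is real, so it passes through the real-linear L and is absorbed
    here.\<close>
  define G where "G = (\<lambda>u. F' (complex_of_real (inverse \<epsilon>) *s u))"
  have "(\<psi> \<circ> h has_derivative L \<circ> (\<lambda>v. inverse \<epsilon> *\<^sub>R v)) (at z1)"
    by (rule diff_chain_at[OF h']) (simp add: h_z1 L)
  moreover have "(F has_derivative F') (at ((\<psi> \<circ> h) z1))"
    using F'(2) by (simp add: h_z1)
  ultimately have "(F \<circ> (\<psi> \<circ> h) has_derivative F' \<circ> (L \<circ> (\<lambda>v. inverse \<epsilon> *\<^sub>R v))) (at z1)"
    by (rule diff_chain_at)
  moreover have "F' \<circ> (L \<circ> (\<lambda>v. inverse \<epsilon> *\<^sub>R v)) = G \<circ> L"
    using has_derivative_linear[OF L]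
    by (simp add: fun_eq_iff G_def linear_scale del: of_real_inverse flip: scaleR_eq_vector_smult)
  ultimately have "(F \<circ> (\<psi> \<circ> h) has_derivative G \<circ> L) (at z1)"
    by simp
  then have "(\<psi> has_derivative G \<circ> L) (at z1)"
  proof (rule has_derivative_transform_within_open)
    have "continuous_on UNIV h"
      unfolding h_def by (intro continuous_intros)
    then show "open (h -` A)"
      using open_A by (rule open_vimage[rotated])
    show "z1 \<in> h -` A"
      using assms(1) by (simp add: h_z1)
    fix x assume "x \<in> h -` A"
    then have "F (\<psi> (h x)) = \<psi> (z1 + complex_of_real \<epsilon> *s id (h x - z0))"
      by (intro F(2)[symmetric]) simp
    also have "z1 + complex_of_real \<epsilon> *s id (h x - z0) = x"
      using \<epsilon> unfolding h_def scaleR_eq_vector_smult[symmetric] by simp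
    finally show "(F \<circ> (\<psi> \<circ> h)) x = \<psi> x"
      by simp
  qed
  moreover have "Vector_Spaces.linear (*s) (*s) G"
    using F'(1) unfolding G_def
    by (simp add: Vector_Spaces.linear_iff vec.vector_space_axioms vector_smult_assoc vector_add_ldistrib mult.commute)
  ultimately show ?thesis
    by blast
qed

text \<open>Differentiate the intertwining relation at a fixed point of the contraction: the same L
  then stands on both sides, and uniqueness of the derivative gives the identity up to the real
  factor \<epsilon>.\<close>

lemma derivative_intertwines:
  assumes "z0 \<in> A" and L: "(\<psi> has_derivative L) (at z0)"
    and D: "Vector_Spaces.linear (*s) (*s) D"
  shows "\<exists>G. Vector_Spaces.linear (*s) (*s) G \<and> (\<forall>v. L (D v) = G (L v))"
proof -
  obtain \<epsilon> F where \<epsilon>: "0 < \<epsilon>" and F: "holomorphic_map_on F B"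
    "\<And>z. z \<in> A \<Longrightarrow> \<psi> (z0 + complex_of_real \<epsilon> *s D (z - z0)) = F (\<psi> z)"
    using ex_affine_intertwined[OF assms(1) D] by metis
  define f where "f = (\<lambda>z. z0 + \<epsilon> *\<^sub>R D (z - z0))"
  have "D 0 = 0"
    using D by (simp add: vec.linear_0)
  then have f_z0: "f z0 = z0"
    by (simp add: f_def)
  have "((\<lambda>z. z - z0) has_derivative (\<lambda>v. v)) (at z0)"
    by (auto intro!: derivative_eq_intros)
  then have "((\<lambda>z. D (z - z0)) has_derivative D) (at z0)"
    by (rule bounded_linear.has_derivative[OF complex_linear_imp_bounded_linear[OF D]])
  then have f': "(f has_derivative (\<lambda>v. \<epsilon> *\<^sub>R D v)) (at z0)"
    unfolding f_def by (auto intro!: derivative_eq_intros)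
  obtain F' where F': "Vector_Spaces.linear (*s) (*s) F'" "(F has_derivative F') (at (\<psi> z0))"
    using F(1) assms(1) unfolding holomorphic_map_on_open[OF open_B] by (meson \<psi>_in)
  have "(\<psi> \<circ> f has_derivative L \<circ> (\<lambda>v. \<epsilon> *\<^sub>R D v)) (at z0)"
    by (rule diff_chain_at[OF f']) (simp add: f_z0 L)
  moreover have "(\<psi> \<circ> f has_derivative F' \<circ> L) (at z0)"
    by (rule has_derivative_transform_within_open[OF diff_chain_at[OF L F'(2)] open_A assms(1)])
      (simp add: f_def F(2)[symmetric] scaleR_eq_vector_smult)
  ultimately have eq: "L \<circ> (\<lambda>v. \<epsilon> *\<^sub>R D v) = F' \<circ> L"
    by (rule has_derivative_unique)
  have "L (D v) = complex_of_real (inverse \<epsilon>) *s F' (L v)" for v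
  proof -
    have "F' (L v) = \<epsilon> *\<^sub>R L (D v)"
      using fun_cong[OF eq, of v] has_derivative_linear[OF L] by (simp add: linear_scale)
    then show ?thesis
      using \<epsilon> by (simp del: of_real_inverse flip: scaleR_eq_vector_smult)
  qed
  then show ?thesis
    using vec.linear_compose_scale_right[OF F'(1)] by blast
qed

text \<open>The alternative is a zero derivative at \<open>z0\<close>. Transport would make it zero
  everywhere, so \<psi> would be constant on the connected set A, and the injectivity of \<psi>
  would reduce the open set A to a point.\<close>

lemma inj_derivative:
  assumes "z0 \<in> A" and L: "(\<psi> has_derivative L) (at z0)"
  shows "inj L"
proof (rule ccontr)
  assume "\<not> inj L"
  then have "L v = 0" for v
    using intertwining_complex_endomorphisms_zero_or_inj[OF has_derivative_linear[OF L]]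
      derivative_intertwines[OF assms] by blast
  then have "(\<psi> has_derivative (\<lambda>v. 0)) (at z)" if "z \<in> A" for z
    using derivative_transport[OF assms that] by (auto simp: o_def vec.linear_0)
  then have "\<psi> constant_on A"
    using A by (intro has_derivative_zero_connected_constant_on[of A "{}"] cont_\<psi>)
      (auto simp: is_domain_def has_derivative_at_withinI)
  then have "\<psi> z = \<psi> z0" if "z \<in> A" for z
    using assms(1) that unfolding constant_on_def by metis
  then have "z = z0" if "z \<in> A" for z
    using assms(1) that \<theta>_\<psi> by metis
  then have "A = {z0}"
    using assms(1) by blast
  then show False
    using open_A not_open_singleton by metis
qed

lemma bij_derivative:
  assumes "z0 \<in> A" and L: "(\<psi> has_derivative L) (at z0)"
  shows "bij L"
proof -
  have "linear L"
    using L has_derivative_linear by blast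
  then have "dim (range L) = dim (UNIV :: (complex ^ 'n) set)"
    using inj_derivative[OF assms] by (intro dim_image_eq) auto
  then have "dim (range L) = DIM(complex ^ 'm)"
    by (simp add: CARD_eq)
  then have "span (range L) = UNIV"
    by (simp only: dim_eq_full)
  then have "surj L"
    using \<open>linear L\<close> by (metis linear_span_image span_UNIV)
  then show ?thesis
    using inj_derivative[OF assms] by (rule bijI[rotated])
qed

lemma biholomorphic_or_antibiholomorphic: "biholomorphic \<psi> A B \<or> antibiholomorphic \<psi> A B"
proof -
  obtain z0 L where z0: "z0 \<in> A" and L: "(\<psi> has_derivative L) (at z0)"
    using ex_differentiable by blast
  consider (lin) "\<forall>v. L (\<i> *s v) = \<i> *s L v" | (anti) "\<forall>v. L (\<i> *s v) = - (\<i> *s L v)"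
    using intertwining_complex_endomorphisms_linear_or_antilinear[OF has_derivative_linear[OF L]
        bij_derivative[OF z0 L]] derivative_intertwines[OF z0 L] by blast
  then show ?thesis
  proof cases
    case lin
    have "biholomorphic \<psi> A B"
    proof (rule biholomorphicI[OF open_A open_B homeo])
      fix z assume z: "z \<in> A"
      then obtain G where G: "Vector_Spaces.linear (*s) (*s) G" "(\<psi> has_derivative G \<circ> L) (at z)"
        using derivative_transport[OF z0 L] by blast
      then have "Vector_Spaces.linear (*s) (*s) (G \<circ> L)"
        unfolding complex_linear_iff[of "G \<circ> L"] using lin has_derivative_linear[OF G(2)]
        by (simp add: vec.linear_scale)
      then show "\<exists>L. (\<psi> has_derivative L) (at z) \<and> bij L \<and> Vector_Spaces.linear (*s) (*s) L"
        using G(2) bij_derivative[OF z G(2)] by blast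
    qed
    then show ?thesis ..
  next
    case anti
    have "biholomorphic (vec_cnj \<circ> \<psi>) A (vec_cnj ` B)"
    proof (rule biholomorphicI[OF open_A open_image_vec_cnj[OF open_B]
          homeomorphism_compose[OF homeo homeomorphism_vec_cnj]])
      fix z assume z: "z \<in> A"
      then obtain G where G: "Vector_Spaces.linear (*s) (*s) G" "(\<psi> has_derivative G \<circ> L) (at z)"
        using derivative_transport[OF z0 L] by blast
      have neg: "G (- u) = - G u" for u
        using G(1) by (rule vec.linear_neg)
      have "(vec_cnj has_derivative vec_cnj) (at (\<psi> z))"
        by (rule bounded_linear_imp_has_derivative[OF bounded_linear_vec_cnj])
      from diff_chain_at[OF G(2) this]
      have der: "(vec_cnj \<circ> \<psi> has_derivative vec_cnj \<circ> (G \<circ> L)) (at z)" .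
      have "vec_cnj (- u) = - vec_cnj u" for u :: "complex ^ 'm"
        by (simp add: vec_cnj_def vec_eq_iff)
      \<comment> \<open>L and the conjugation each turn \<i> into its negative, and the two signs
        cancel.\<close>
      then have "Vector_Spaces.linear (*s) (*s) (vec_cnj \<circ> (G \<circ> L))"
        unfolding complex_linear_iff[of "vec_cnj \<circ> (G \<circ> L)"]
        using anti has_derivative_linear[OF der] vec.linear_scale[OF G(1)] neg
        by (simp add: vec_cnj_smult)
      moreover have "bij (vec_cnj \<circ> (G \<circ> L))"
        by (rule bij_comp[OF bij_derivative[OF z G(2)] bij_vec_cnj])
      ultimately show "\<exists>L. (vec_cnj \<circ> \<psi> has_derivative L) (at z) \<and> bij L \<and> Vector_Spaces.linear (*s) (*s) L"
        using der by blast
    qed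
    then show ?thesis
      by (simp add: antibiholomorphic_def)
  qed
qed

end

subsection \<open>Isomorphisms of endomorphism semigroups\<close>

lemma continuous_on_inv_into_open_map:
  fixes f :: "'a::topological_space \<Rightarrow> 'b::topological_space"
  assumes "open A" and "open B" and bij: "bij_betw f A B"
    and op: "\<And>U. open U \<Longrightarrow> U \<subseteq> A \<Longrightarrow> open (f ` U)"
  shows "continuous_on B (inv_into A f)"
  unfolding continuous_on_open_vimage[OF \<open>open B\<close>]
proof (intro allI impI)
  fix V :: "'a set" assume "open V"
  then have "open (f ` (V \<inter> A))"
    using \<open>open A\<close> by (intro op) auto
  moreover have "inv_into A f -` V \<inter> B = f ` (V \<inter> A)"
    using bij by (auto simp: bij_betw_def)
  ultimately show "open (inv_into A f -` V \<inter> B)"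
    by simp
qed

text \<open>The two intertwining relations play crossed roles: the forward one makes \<psi> open,
  hence its inverse continuous, and the backward one makes the inverse open, hence \<psi>
  continuous.\<close>

lemma intertwinerI:
  fixes A :: "(complex ^ 'n) set" and B :: "(complex ^ 'm) set"
  assumes A: "is_domain A" "bounded A" and B: "is_domain B" "bounded B" and bij: "bij_betw \<psi> A B"
    and fwd: "\<And>f. holomorphic_map_on f A \<Longrightarrow> f \<in> A \<rightarrow> A \<Longrightarrow>
      \<exists>F. holomorphic_map_on F B \<and> F \<in> B \<rightarrow> B \<and> (\<forall>z\<in>A. \<psi> (f z) = F (\<psi> z))"
    and bwd: "\<And>F. holomorphic_map_on F B \<Longrightarrow> F \<in> B \<rightarrow> B \<Longrightarrow>
      \<exists>f. holomorphic_map_on f A \<and> f \<in> A \<rightarrow> A \<and>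
        (\<forall>w\<in>B. inv_into A \<psi> (F w) = f (inv_into A \<psi> w))"
  shows "intertwiner A B \<psi> (inv_into A \<psi>)"
proof
  have op: "open A" "open B"
    using A B by (simp_all add: is_domain_def)
  have bij': "bij_betw (inv_into A \<psi>) B A"
    by (rule bij_betw_inv_into[OF bij])
  have "continuous_on B (inv_into A \<psi>)"
    by (rule continuous_on_inv_into_open_map[OF op bij open_image_intertwiner[OF op(1) A(2) op(2) bij fwd]])
  moreover have "continuous_on A (inv_into B (inv_into A \<psi>))"
    by (rule continuous_on_inv_into_open_map[OF op(2,1) bij' open_image_intertwiner[OF op(2) B(2) op(1) bij' bwd]])
  then have "continuous_on A \<psi>"
    using inv_into_inv_into_eq[OF bij] continuous_on_cong by metis
  ultimately show "homeomorphism A B \<psi> (inv_into A \<psi>)"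
    using bij bij' by (auto simp: homeomorphism_def bij_betw_def f_inv_into_f)
qed (fact A B fwd)+

lemma mem_carrier_holo_endo:
  "f \<in> carrier (holo_endo A) \<longleftrightarrow> f \<in> A \<rightarrow>\<^sub>E A \<and> holomorphic_map_on f A"
  by (simp add: holo_endo_def)

lemma mult_holo_endo [simp]: "f \<otimes>\<^bsub>holo_endo A\<^esub> g = compose A f g"
  by (simp add: holo_endo_def)

lemma restrict_mem_carrier_holo_endo:
  assumes "holomorphic_map_on f A" and "f \<in> A \<rightarrow> A"
  shows "restrict f A \<in> carrier (holo_endo A)"
  using holomorphic_map_on_cong[OF assms(1), of "restrict f A"] assms(2)
  by (simp add: mem_carrier_holo_endo)

lemma holomorphic_map_on_const: "holomorphic_map_on (\<lambda>_. w) A"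
  unfolding holomorphic_map_on_def
  using has_derivative_const vec.linear_zero by blast

text \<open>An isomorphism preserves the left zeros of the semigroups, which are exactly the constant maps.\<close>

lemma iso_holo_endo_conjugation:
  fixes A :: "(complex ^ 'n) set" and B :: "(complex ^ 'm) set"
  assumes ne: "A \<noteq> {}" "B \<noteq> {}" and iso: "\<phi> \<in> iso (holo_endo A) (holo_endo B)"
  obtains \<psi> where "bij_betw \<psi> A B"
    and "\<And>f z. f \<in> carrier (holo_endo A) \<Longrightarrow> z \<in> A \<Longrightarrow> \<phi> f (\<psi> z) = \<psi> (f z)"
proof -
  let ?E = "carrier (holo_endo A)" and ?H = "carrier (holo_endo B)"
  have bij: "bij_betw \<phi> ?E ?H"
    using iso by (simp add: iso_def)
  have mult: "\<phi> (compose A f g) = compose B (\<phi> f) (\<phi> g)" if "f \<in> ?E" "g \<in> ?E" for f g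
    using hom_mult[of \<phi> "holo_endo A" "holo_endo B" f g] iso that by (simp add: iso_def)
  have closed: "\<phi> f \<in> ?H" if "f \<in> ?E" for f
    using bij that by (auto simp: bij_betw_def)
  have funA: "f z \<in> A" if "f \<in> ?E" "z \<in> A" for f z
    using that by (auto simp: mem_carrier_holo_endo)
  have funB: "F w \<in> B" if "F \<in> ?H" "w \<in> B" for F w
    using that by (auto simp: mem_carrier_holo_endo)
  define cA where "cA = (\<lambda>z. restrict (\<lambda>_ :: complex ^ 'n. z :: complex ^ 'n) A)"
  define cB where "cB = (\<lambda>w. restrict (\<lambda>_ :: complex ^ 'm. w :: complex ^ 'm) B)"
  have cA: "cA z \<in> ?E" if "z \<in> A" for z
    unfolding cA_def using that by (intro restrict_mem_carrier_holo_endo holomorphic_map_on_const) auto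
  have cB: "cB w \<in> ?H" if "w \<in> B" for w
    unfolding cB_def using that by (intro restrict_mem_carrier_holo_endo holomorphic_map_on_const) auto
  have compA: "compose A f (cA z) = cA (f z)" "compose A (cA z) f = cA z" if "f \<in> ?E" "z \<in> A" for f z
    using funA that by (auto simp: cA_def compose_def fun_eq_iff)
  have compB: "compose B F (cB w) = cB (F w)" "compose B (cB w) F = cB w" if "F \<in> ?H" "w \<in> B" for F w
    using funB that by (auto simp: cB_def compose_def fun_eq_iff)
  obtain a b where a: "a \<in> A" and b: "b \<in> B"
    using ne by blast
  \<comment> \<open>The image of a constant map turns out to be constant, so its value can be read
    off at any point b.\<close>
  define \<psi> where "\<psi> = (\<lambda>z. \<phi> (cA z) b)"
  have \<psi>B: "\<psi> z \<in> B" if "z \<in> A" for z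
    unfolding \<psi>_def using funB[OF closed[OF cA[OF that]] b] .
  have \<phi>_c: "\<phi> (cA z) = cB (\<psi> z)" if z: "z \<in> A" for z
  proof -
    \<comment> \<open>Composing the left zero \<open>cA z\<close> with this g changes nothing, but
      after \<phi> it becomes composition with a constant map, which is constant.\<close>
    obtain g where g: "g \<in> ?E" "\<phi> g = cB b"
      using cB[OF b] unfolding bij_betw_imp_surj_on[OF bij, symmetric] by (metis imageE)
    have "\<phi> (cA z) = \<phi> (compose A (cA z) g)"
      using compA(2)[OF g(1) z] by simp
    also have "\<dots> = compose B (\<phi> (cA z)) (cB b)"
      using mult[OF cA[OF z] g(1)] g(2) by simp
    also have "\<dots> = cB (\<psi> z)"
      using compB(1)[OF closed[OF cA[OF z]] b] by (simp add: \<psi>_def)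
    finally show ?thesis .
  qed
  have cA_inj: "z = z'" if "cA z = cA z'" for z z'
    using fun_cong[OF that, of a] a by (simp add: cA_def)
  have cB_inj: "w = w'" if "cB w = cB w'" for w w'
    using fun_cong[OF that, of b] b by (simp add: cB_def)
  show ?thesis
  proof
    show "bij_betw \<psi> A B"
      unfolding bij_betw_def
    proof (intro conjI inj_onI subset_antisym subsetI)
      fix x y assume "x \<in> A" "y \<in> A" "\<psi> x = \<psi> y"
      then have "cA x = cA y"
        using bij cA \<phi>_c unfolding bij_betw_def by (metis inj_onD)
      then show "x = y"
        by (rule cA_inj)
    next
      fix w assume "w \<in> \<psi> ` A"
      then show "w \<in> B"
        using \<psi>B by blast
    next
      fix w assume w: "w \<in> B"
      then obtain f where f: "f \<in> ?E" "\<phi> f = cB w"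
        using cB[OF w] unfolding bij_betw_imp_surj_on[OF bij, symmetric] by (metis imageE)
      \<comment> \<open>The preimage f of a constant map is not yet known to be constant; composing
        it with \<open>cA a\<close> produces a constant map with the same image.\<close>
      have "\<phi> (cA (f a)) = compose B (\<phi> f) (\<phi> (cA a))"
        using mult[OF f(1) cA[OF a]] compA(1)[OF f(1) a] by simp
      also have "\<dots> = cB w"
        using compB(2)[OF closed[OF cA[OF a]] w] f(2) by simp
      finally have "cB (\<psi> (f a)) = cB w"
        using \<phi>_c[OF funA[OF f(1) a]] by simp
      then have "\<psi> (f a) = w"
        by (rule cB_inj)
      then show "w \<in> \<psi> ` A"
        using funA[OF f(1) a] by blast
    qed
    fix f z assume f: "f \<in> ?E" and z: "z \<in> A"
    have "cB (\<psi> (f z)) = \<phi> (compose A f (cA z))"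
      using \<phi>_c[OF funA[OF f z]] compA(1)[OF f z] by simp
    also have "\<dots> = cB (\<phi> f (\<psi> z))"
      using mult[OF f cA[OF z]] \<phi>_c[OF z] compB(1)[OF closed[OF f] \<psi>B[OF z]] by simp
    finally show "\<phi> f (\<psi> z) = \<psi> (f z)"
      using cB_inj by metis
  qed
qed

theorem theorem4p2p1:
  fixes \<Omega>\<^sub>1 :: "(complex ^ 'n) set"
    and \<Omega>\<^sub>2 :: "(complex ^ 'm) set"
    and \<phi> :: "(complex ^ 'n \<Rightarrow> complex ^ 'n) \<Rightarrow> (complex ^ 'm \<Rightarrow> complex ^ 'm)"
  assumes "is_domain \<Omega>\<^sub>1" and "bounded \<Omega>\<^sub>1"
    and "is_domain \<Omega>\<^sub>2" and "bounded \<Omega>\<^sub>2"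
    and "\<phi> \<in> iso (holo_endo \<Omega>\<^sub>1) (holo_endo \<Omega>\<^sub>2)"
    and "\<phi> \<one>\<^bsub>holo_endo \<Omega>\<^sub>1\<^esub> = \<one>\<^bsub>holo_endo \<Omega>\<^sub>2\<^esub>"
  shows "CARD('n) = CARD('m) \<and>
    (\<exists>\<psi>. (biholomorphic \<psi> \<Omega>\<^sub>1 \<Omega>\<^sub>2 \<or> antibiholomorphic \<psi> \<Omega>\<^sub>1 \<Omega>\<^sub>2) \<and>
         (\<forall>f \<in> carrier (holo_endo \<Omega>\<^sub>1).
            \<phi> f = restrict (\<psi> \<circ> f \<circ> inv_into \<Omega>\<^sub>1 \<psi>) \<Omega>\<^sub>2))"
proof -
  obtain \<psi> where bij: "bij_betw \<psi> \<Omega>\<^sub>1 \<Omega>\<^sub>2"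
    and conj: "\<And>f z. f \<in> carrier (holo_endo \<Omega>\<^sub>1) \<Longrightarrow> z \<in> \<Omega>\<^sub>1 \<Longrightarrow> \<phi> f (\<psi> z) = \<psi> (f z)"
    using iso_holo_endo_conjugation[of \<Omega>\<^sub>1 \<Omega>\<^sub>2 \<phi>] assms(1,3,5) unfolding is_domain_def by metis
  have \<phi>: "bij_betw \<phi> (carrier (holo_endo \<Omega>\<^sub>1)) (carrier (holo_endo \<Omega>\<^sub>2))"
    using assms(5) by (simp add: iso_def)
  define \<theta> where "\<theta> = inv_into \<Omega>\<^sub>1 \<psi>"
  have \<theta>: "\<theta> w \<in> \<Omega>\<^sub>1" "\<psi> (\<theta> w) = w" if "w \<in> \<Omega>\<^sub>2" for w
    using bij that by (auto simp: \<theta>_def bij_betw_def inv_into_into f_inv_into_f)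
  have \<theta>\<psi>: "\<theta> (\<psi> z) = z" if "z \<in> \<Omega>\<^sub>1" for z
    using bij that by (simp add: \<theta>_def bij_betw_def)
  have "intertwiner \<Omega>\<^sub>1 \<Omega>\<^sub>2 \<psi> (inv_into \<Omega>\<^sub>1 \<psi>)"
  proof (rule intertwinerI[OF assms(1-4) bij], goal_cases)
    case (1 f)
    then have f: "restrict f \<Omega>\<^sub>1 \<in> carrier (holo_endo \<Omega>\<^sub>1)"
      by (rule restrict_mem_carrier_holo_endo)
    then have "\<phi> (restrict f \<Omega>\<^sub>1) \<in> carrier (holo_endo \<Omega>\<^sub>2)"
      using \<phi> by (auto simp: bij_betw_def)
    moreover have "\<psi> (f z) = \<phi> (restrict f \<Omega>\<^sub>1) (\<psi> z)" if "z \<in> \<Omega>\<^sub>1" for z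
      using conj[OF f that] that by simp
    ultimately show ?case
      by (auto simp: mem_carrier_holo_endo)
  next
    \<comment> \<open>Surjectivity of \<phi> provides the endomorphism of
      \<open>\<Omega>\<^sub>1\<close> whose conjugate is F; restriction puts F into the extensional
      carrier.\<close>
    case (2 F)
    then have "restrict F \<Omega>\<^sub>2 \<in> carrier (holo_endo \<Omega>\<^sub>2)"
      by (rule restrict_mem_carrier_holo_endo)
    then obtain f where f: "f \<in> carrier (holo_endo \<Omega>\<^sub>1)" "\<phi> f = restrict F \<Omega>\<^sub>2"
      unfolding bij_betw_imp_surj_on[OF \<phi>, symmetric] by (metis imageE)
    have "\<theta> (F w) = f (\<theta> w)" if w: "w \<in> \<Omega>\<^sub>2" for w
    proof -
      have "F w = \<psi> (f (\<theta> w))"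
        using conj[OF f(1) \<theta>(1)[OF w]] f(2) w by (simp add: \<theta>)
      moreover have "f (\<theta> w) \<in> \<Omega>\<^sub>1"
        using f(1) \<theta>(1)[OF w] by (auto simp: mem_carrier_holo_endo)
      ultimately show ?thesis
        by (simp add: \<theta>\<psi>)
    qed
    then show ?case
      using f(1) unfolding \<theta>_def by (auto simp: mem_carrier_holo_endo)
  qed
  then interpret intertwiner \<Omega>\<^sub>1 \<Omega>\<^sub>2 \<psi> "inv_into \<Omega>\<^sub>1 \<psi>" .
  have "\<phi> f = restrict (\<psi> \<circ> f \<circ> inv_into \<Omega>\<^sub>1 \<psi>) \<Omega>\<^sub>2" if f: "f \<in> carrier (holo_endo \<Omega>\<^sub>1)" for f
  proof (rule extensionalityI)
    have "\<phi> f \<in> carrier (holo_endo \<Omega>\<^sub>2)"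
      using \<phi> f by (auto simp: bij_betw_def)
    then show "\<phi> f \<in> extensional \<Omega>\<^sub>2"
      by (auto simp: mem_carrier_holo_endo PiE_def)
    show "\<phi> f w = restrict (\<psi> \<circ> f \<circ> inv_into \<Omega>\<^sub>1 \<psi>) \<Omega>\<^sub>2 w" if "w \<in> \<Omega>\<^sub>2" for w
      using conj[OF f \<theta>(1)[OF that]] that \<theta>(2)[OF that] by (simp add: \<theta>_def)
  qed simp
  then show ?thesis
    using CARD_eq biholomorphic_or_antibiholomorphic by blast
qed

end
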